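(* Consider the asymptotic rare/weak model $ARW(r,\beta)$: $\epsilon=p^{-\beta}$, $\tau=\sqrt{2r\log p}$, $n\sim c(\log p)^{\gamma}$, $p\to\infty$, with $(\beta,r)\in(0,1)^2$. Let $$\rho^*(\beta)=\begin{cases}0,&0<\beta\le 1/2,\\ \beta-1/2,&1/2<\beta\le 3/4,\\ (1-\sqrt{1-\beta})^2,&3/4<\beta<1.\end{cases}$$ Let the threshold function $\eta_t$ be any of clipping, hard thresholding or soft thresholding. Define the success region as the interior of the set of $(\beta,r)$ for which the ideal threshold satisfies $\widetilde{Err}(T_{ideal}(\epsilon,\tau);\epsilon,\tau,p,n)\to 0$ as $p\to\infty$. Then the success region is precisely $r>\rho^*(\beta)$, $0<\beta<1$. In the interior of the complementary region $r<\rho^*(\beta)$, $1/2<\beta<1$, even the ideal threshold cannot send the (normalized) proxy separation $\sqrt{p/n}\;\widetilde{Sep}(T_{ideal}(\epsilon,\tau);\epsilon,\tau)$ to infinity with increasing $(n,p)$.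
   Context: $W$ denotes a standard normal random variable and $\Phi$ the standard normal distribution function. The threshold function $\eta_t$ is any one of: clipping $\eta_t(z)=\mathrm{sgn}(z)1_{\{|z|>t\}}$; hard thresholding $\eta_t(z)=z\,1_{\{|z|>t\}}$; soft thresholding $\eta_t(z)=\mathrm{sgn}(z)(|z|-t)_+$. The proxy separation is $\widetilde{Sep}(t;\epsilon,\tau)=2A/\sqrt B$ with $A=\epsilon\,\tau\,E\{\eta_t(\tau+W)\}$ and $B=\epsilon\,E\{\eta_t^2(\tau+W)\}+(1-\epsilon)\,E\{\eta_t^2(W)\}$. The proxy classification error is $\widetilde{Err}(t;\epsilon,\tau,p,n)=\Phi\left(-\tfrac12\sqrt{p/n}\;\widetilde{Sep}(t;\epsilon,\tau)\right)$. The ideal threshold is $T_{ideal}(\epsilon,\tau)=\arg\max_{t}\widetilde{Sep}(t;\epsilon,\tau)$. In $ARW(r,\beta)$, $c,\gamma>0$ are fixed constants; $a_p\sim b_p$ means $a_p/b_p\to1$. *)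

theory Defs
  imports "HOL-Probability.Probability" "HOL-Library.Landau_Symbols"
begin

definition clip_thresh :: "real \<Rightarrow> real \<Rightarrow> real" where
  "clip_thresh t z = (if \<bar>z\<bar> > t then sgn z else 0)"

definition hard_thresh :: "real \<Rightarrow> real \<Rightarrow> real" where
  "hard_thresh t z = (if \<bar>z\<bar> > t then z else 0)"

definition soft_thresh :: "real \<Rightarrow> real \<Rightarrow> real" where
  "soft_thresh t z = sgn z * max 0 (\<bar>z\<bar> - t)"

definition normal_expect :: "(real \<Rightarrow> real) \<Rightarrow> real" where
  "normal_expect f = (\<integral>w. f w \<partial>std_normal_distribution)"

definition sep_numer :: "(real \<Rightarrow> real \<Rightarrow> real) \<Rightarrow> real \<Rightarrow> real \<Rightarrow> real \<Rightarrow> real" where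
  "sep_numer \<eta> \<epsilon> \<tau> t = \<epsilon> * \<tau> * normal_expect (\<lambda>w. \<eta> t (\<tau> + w))"

definition sep_denom :: "(real \<Rightarrow> real \<Rightarrow> real) \<Rightarrow> real \<Rightarrow> real \<Rightarrow> real \<Rightarrow> real" where
  "sep_denom \<eta> \<epsilon> \<tau> t =
     \<epsilon> * normal_expect (\<lambda>w. (\<eta> t (\<tau> + w))\<^sup>2)
     + (1 - \<epsilon>) * normal_expect (\<lambda>w. (\<eta> t w)\<^sup>2)"

definition proxy_sep :: "(real \<Rightarrow> real \<Rightarrow> real) \<Rightarrow> real \<Rightarrow> real \<Rightarrow> real \<Rightarrow> real" where
  "proxy_sep \<eta> \<epsilon> \<tau> t = 2 * sep_numer \<eta> \<epsilon> \<tau> t / sqrt (sep_denom \<eta> \<epsilon> \<tau> t)"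

definition proxy_err ::
    "(real \<Rightarrow> real \<Rightarrow> real) \<Rightarrow> real \<Rightarrow> real \<Rightarrow> nat \<Rightarrow> nat \<Rightarrow> real \<Rightarrow> real" where
  "proxy_err \<eta> \<epsilon> \<tau> p n t =
     cdf std_normal_distribution (- (1/2) * sqrt (real p / real n) * proxy_sep \<eta> \<epsilon> \<tau> t)"

(* Thresholds range over t \<ge> 0. The maximiser need not be unique; arg_max selects one, and
   proxy_sep and proxy_err take the same value at every maximiser. For \<epsilon> in (0,1) and
   \<tau> > 0 a maximiser exists: proxy_sep is continuous and positive in t \<ge> 0 and tends to 0
   as t tends to infinity. *)
definition ideal_threshold :: "(real \<Rightarrow> real \<Rightarrow> real) \<Rightarrow> real \<Rightarrow> real \<Rightarrow> real" where
  "ideal_threshold \<eta> \<epsilon> \<tau> = (ARG_MAX (proxy_sep \<eta> \<epsilon> \<tau>) t. t \<ge> 0)"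

definition arw_eps :: "real \<Rightarrow> nat \<Rightarrow> real" where
  "arw_eps \<beta> p = real p powr (- \<beta>)"

definition arw_tau :: "real \<Rightarrow> nat \<Rightarrow> real" where
  "arw_tau r p = sqrt (2 * r * ln (real p))"

definition ideal_sep :: "(real \<Rightarrow> real \<Rightarrow> real) \<Rightarrow> real \<Rightarrow> real \<Rightarrow> nat \<Rightarrow> real" where
  "ideal_sep \<eta> \<beta> r p =
     proxy_sep \<eta> (arw_eps \<beta> p) (arw_tau r p) (ideal_threshold \<eta> (arw_eps \<beta> p) (arw_tau r p))"

definition ideal_err ::
    "(real \<Rightarrow> real \<Rightarrow> real) \<Rightarrow> (nat \<Rightarrow> nat) \<Rightarrow> real \<Rightarrow> real \<Rightarrow> nat \<Rightarrow> real" where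
  "ideal_err \<eta> n \<beta> r p =
     proxy_err \<eta> (arw_eps \<beta> p) (arw_tau r p) p (n p)
       (ideal_threshold \<eta> (arw_eps \<beta> p) (arw_tau r p))"

definition rho_star :: "real \<Rightarrow> real" where
  "rho_star \<beta> =
     (if \<beta> \<le> 1/2 then 0
      else if \<beta> \<le> 3/4 then \<beta> - 1/2
      else (1 - sqrt (1 - \<beta>))\<^sup>2)"

definition arw_square :: "(real \<times> real) set" where
  "arw_square = {0<..<1} \<times> {0<..<1}"

(* Points are pairs (\<beta>, r); n p is the sample size used at dimension p. *)
definition success_region :: "(real \<Rightarrow> real \<Rightarrow> real) \<Rightarrow> (nat \<Rightarrow> nat) \<Rightarrow> (real \<times> real) set" where
  "success_region \<eta> n =
     interior {(\<beta>, r). (\<beta>, r) \<in> arw_square \<and> ideal_err \<eta> n \<beta> r \<longlonglongrightarrow> 0}"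

end

(* Write L = log p. The argument uses only that eta_t is odd and nondecreasing in z, vanishes on
   [-t, t], is at least 1 beyond t + 1 and grows at most linearly.

   Upper bound, valid for every t at once: split E eta_t(tau + W) at tau + W = s with
   s = tau + a sqrt(2L). Below s, the change of measure E f(tau + W) = E f(W) exp(tau W - tau^2/2)
   and Cauchy-Schwarz bring in E eta_t^2(W); above s, Cauchy-Schwarz brings in E eta_t^2(tau + W).
   Both second moments are dominated by the denominator B, so sqrt(p) Sep is at most a power of L
   times p^(1/2 - beta + r - (sqrt r - a)_+^2 / 2) + p^((1 - beta - a^2) / 2). For r < rho_star(beta)
   both exponents are negative when a is slightly larger than sqrt(1 - beta).

   Lower bound: at t = (sqrt r + a) sqrt(2L), sqrt(p) Sep is at least p to the power
   1/2 - beta - a^2 + min(beta + a^2, (sqrt r + a)^2) / 2, up to a factor exp(O(sqrt L)); for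
   r > rho_star(beta) some a makes this exponent positive, and the polylogarithmic n is
   negligible. *)
theory Submission
  imports Defs "HOL-Real_Asymp.Real_Asymp"
begin

section \<open>Cauchy-Schwarz and Gaussian expectations under a shift\<close>

lemma cauchy_schwarz_integral:
  fixes f g :: "'a \<Rightarrow> real"
  assumes [measurable]: "f \<in> borel_measurable M" "g \<in> borel_measurable M"
    and f: "integrable M (\<lambda>x. (f x)\<^sup>2)" and g: "integrable M (\<lambda>x. (g x)\<^sup>2)"
  shows "(\<integral>x. f x * g x \<partial>M) \<le> sqrt (\<integral>x. (f x)\<^sup>2 \<partial>M) * sqrt (\<integral>x. (g x)\<^sup>2 \<partial>M)"
proof -
  define F G where "F = sqrt (\<integral>x. (f x)\<^sup>2 \<partial>M)" and "G = sqrt (\<integral>x. (g x)\<^sup>2 \<partial>M)"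
  have F2: "(\<integral>x. (f x)\<^sup>2 \<partial>M) = F\<^sup>2" and G2: "(\<integral>x. (g x)\<^sup>2 \<partial>M) = G\<^sup>2"
    and "F \<ge> 0" "G \<ge> 0" by (simp_all add: F_def G_def)
  show ?thesis
  proof (cases "F = 0 \<or> G = 0")
    case True
    then have "(\<integral>x. (f x)\<^sup>2 \<partial>M) = 0 \<or> (\<integral>x. (g x)\<^sup>2 \<partial>M) = 0" using F2 G2 by auto
    then have "(AE x in M. (f x)\<^sup>2 = 0) \<or> (AE x in M. (g x)\<^sup>2 = 0)"
      using integral_nonneg_eq_0_iff_AE[OF f] integral_nonneg_eq_0_iff_AE[OF g] by auto
    then have "AE x in M. f x * g x = 0"
      by (auto elim!: AE_mp)
    then have "(\<integral>x. f x * g x \<partial>M) = 0"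
      by (rule integral_eq_zero_AE)
    then show ?thesis using \<open>F \<ge> 0\<close> \<open>G \<ge> 0\<close> by (simp add: F_def G_def)
  next
    case False
    with \<open>F \<ge> 0\<close> \<open>G \<ge> 0\<close> have pos: "F > 0" "G > 0" by auto
    \<comment> \<open>Young's inequality, with weights chosen so that the two terms integrate to
      \<open>F * G / 2\<close> each. The majorant is integrable and nonnegative, as
      \<open>integral_mono'\<close> asks.\<close>
    have "(\<integral>x. f x * g x \<partial>M) \<le> (\<integral>x. (G / (2 * F)) * (f x)\<^sup>2 + (F / (2 * G)) * (g x)\<^sup>2 \<partial>M)"
    proof (rule integral_mono')
      show "integrable M (\<lambda>x. (G / (2 * F)) * (f x)\<^sup>2 + (F / (2 * G)) * (g x)\<^sup>2)"
        using f g by auto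
      fix x
      have "0 \<le> (G * f x - F * g x)\<^sup>2 / (2 * F * G)" using pos by simp
      also have "\<dots> = (G / (2 * F)) * (f x)\<^sup>2 + (F / (2 * G)) * (g x)\<^sup>2 - f x * g x"
        using pos by (simp add: field_simps power2_eq_square)
      finally show "f x * g x \<le> (G / (2 * F)) * (f x)\<^sup>2 + (F / (2 * G)) * (g x)\<^sup>2" by simp
      show "0 \<le> (G / (2 * F)) * (f x)\<^sup>2 + (F / (2 * G)) * (g x)\<^sup>2" using pos by simp
    qed
    also have "\<dots> = (G / (2 * F)) * F\<^sup>2 + (F / (2 * G)) * G\<^sup>2"
      using f g by (simp add: F2 G2)
    also have "\<dots> = F * G" using pos by (simp add: field_simps power2_eq_square)
    finally show ?thesis by (simp add: F_def G_def)
  qed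
qed

lemma normal_expect_lborel:
  assumes [measurable]: "f \<in> borel_measurable borel"
  shows "normal_expect f = (\<integral>w. std_normal_density w * f w \<partial>lborel)"
  unfolding normal_expect_def by (subst integral_density) auto

lemma integrable_std_normal_iff:
  fixes f :: "real \<Rightarrow> real"
  assumes [measurable]: "f \<in> borel_measurable borel"
  shows "integrable std_normal_distribution f \<longleftrightarrow> integrable lborel (\<lambda>w. std_normal_density w * f w)"
  by (subst integrable_density) auto

lemma std_normal_density_tilt:
  "std_normal_density (w - \<theta>) = std_normal_density w * exp (\<theta> * w - \<theta>\<^sup>2 / 2)"
proof -
  have "- (w - \<theta>)\<^sup>2 / 2 = - w\<^sup>2 / 2 + (\<theta> * w - \<theta>\<^sup>2 / 2)"
    by (simp add: field_simps power2_eq_square)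
  then show ?thesis unfolding std_normal_density_def by (simp only: exp_add)
qed

text \<open>Cameron-Martin shift: a translation of the variable moves \<open>\<theta>\<close> from
  the integrand into the density, and the exponential is the likelihood ratio. Integrability is
  preserved, so both sides take the default value 0 together when it fails.\<close>

lemma normal_expect_tilt:
  assumes [measurable]: "f \<in> borel_measurable borel"
  shows "normal_expect (\<lambda>w. f (\<theta> + w)) = normal_expect (\<lambda>w. f w * exp (\<theta> * w - \<theta>\<^sup>2 / 2))"
  by (simp add: normal_expect_lborel
      lborel_integral_real_affine[where c = 1 and t = "- \<theta>" and f = "\<lambda>w. std_normal_density w * f (\<theta> + w)"]
      std_normal_density_tilt mult_ac)

lemma integrable_normal_tilt:
  fixes f :: "real \<Rightarrow> real"
  assumes [measurable]: "f \<in> borel_measurable borel"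
  shows "integrable std_normal_distribution (\<lambda>w. f (\<theta> + w)) \<longleftrightarrow>
    integrable std_normal_distribution (\<lambda>w. f w * exp (\<theta> * w - \<theta>\<^sup>2 / 2))"
  using lborel_integrable_real_affine_iff[where c = 1 and t = "- \<theta>" and f = "\<lambda>w. std_normal_density w * f (\<theta> + w)"]
  by (simp add: integrable_std_normal_iff std_normal_density_tilt mult_ac)

lemma normal_expect_uminus:
  assumes [measurable]: "f \<in> borel_measurable borel"
  shows "normal_expect (\<lambda>w. f (- w)) = normal_expect f"
  using lborel_integral_real_affine[of "-1" "\<lambda>w. std_normal_density w * f w" 0]
  by (simp add: normal_expect_lborel std_normal_density_def)

lemma prob_space_std_normal: "prob_space std_normal_distribution"
  using real_dist_normal_dist by (simp add: real_distribution_def)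

lemma normal_expect_const [simp]: "normal_expect (\<lambda>_. c) = c"
  using prob_space.prob_space[OF prob_space_std_normal] by (simp add: normal_expect_def)

lemma integrable_normal_const [simp]: "integrable std_normal_distribution (\<lambda>_. c :: real)"
  using prob_space_std_normal by (simp add: prob_space.finite_measure finite_measure.integrable_const)

lemma normal_expect_square: "normal_expect (\<lambda>w. w\<^sup>2) = 1"
  using std_normal_distribution_even_moments(1)[of 1] by (simp add: normal_expect_def)

lemma normal_expect_mono:
  assumes "integrable std_normal_distribution g" "\<And>w. f w \<le> g w" "\<And>w. 0 \<le> g w"
  shows "normal_expect f \<le> normal_expect g"
  unfolding normal_expect_def using assms by (intro integral_mono') auto

text \<open>The quadratic bound is shared by \<open>\<eta> t\<close>, its square and their products
  with indicators; a finite second moment of the normal law then suffices for any shift.\<close>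

lemma integrable_normal_growth:
  fixes f :: "real \<Rightarrow> real"
  assumes [measurable]: "f \<in> borel_measurable borel"
    and bound: "\<And>z. \<bar>f z\<bar> \<le> K * (1 + \<bar>z\<bar>)\<^sup>2"
  shows "integrable std_normal_distribution (\<lambda>w. f (\<theta> + w))"
proof (rule Bochner_Integration.integrable_bound)
  show "integrable std_normal_distribution (\<lambda>w. \<bar>K\<bar> * (2 * (1 + \<bar>\<theta>\<bar>)\<^sup>2 + 2 * w\<^sup>2))"
    using integrable_std_normal_distribution_moment[of 2] by auto
  have "\<bar>f (\<theta> + w)\<bar> \<le> \<bar>K\<bar> * (2 * (1 + \<bar>\<theta>\<bar>)\<^sup>2 + 2 * w\<^sup>2)" for w
  proof -
    have "(1 + \<bar>\<theta> + w\<bar>)\<^sup>2 \<le> ((1 + \<bar>\<theta>\<bar>) + \<bar>w\<bar>)\<^sup>2" by (intro power_mono) auto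
    also have "\<dots> \<le> 2 * (1 + \<bar>\<theta>\<bar>)\<^sup>2 + 2 * w\<^sup>2"
      using sum_squares_bound[of "1 + \<bar>\<theta>\<bar>" "\<bar>w\<bar>"] by (simp add: power2_sum)
    finally have *: "(1 + \<bar>\<theta> + w\<bar>)\<^sup>2 \<le> 2 * (1 + \<bar>\<theta>\<bar>)\<^sup>2 + 2 * w\<^sup>2" .
    have "\<bar>f (\<theta> + w)\<bar> \<le> K * (1 + \<bar>\<theta> + w\<bar>)\<^sup>2" by (rule bound)
    also have "\<dots> \<le> \<bar>K\<bar> * (1 + \<bar>\<theta> + w\<bar>)\<^sup>2" by (intro mult_right_mono) auto
    also have "\<dots> \<le> \<bar>K\<bar> * (2 * (1 + \<bar>\<theta>\<bar>)\<^sup>2 + 2 * w\<^sup>2)" using * by (intro mult_left_mono) auto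
    finally show ?thesis .
  qed
  then show "AE w in std_normal_distribution. norm (f (\<theta> + w)) \<le> norm (\<bar>K\<bar> * (2 * (1 + \<bar>\<theta>\<bar>)\<^sup>2 + 2 * w\<^sup>2))"
    by (intro AE_I2) (auto simp: abs_mult intro: order_trans)
qed simp

lemma integrable_normal_indicator:
  assumes "S \<in> sets borel"
  shows "integrable std_normal_distribution (\<lambda>w. indicat_real S (\<theta> + w))"
proof (rule integrable_normal_growth[where K = 1])
  show "indicat_real S \<in> borel_measurable borel" using assms by simp
  have "1 \<le> (1 + \<bar>z\<bar>)\<^sup>2" for z :: real using one_le_power[of "1 + \<bar>z\<bar>" 2] by simp
  then show "\<bar>indicat_real S z\<bar> \<le> 1 * (1 + \<bar>z\<bar>)\<^sup>2" for z by (auto simp: indicator_def)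
qed

section \<open>Gaussian tail bounds with polynomial weights\<close>

lemma normal_expect_upper_tail:
  assumes [measurable]: "g \<in> borel_measurable borel"
    and int: "integrable std_normal_distribution (\<lambda>w. g (x + w))"
    and "\<And>z. 0 \<le> g z" and "x \<ge> 0"
  shows "normal_expect (\<lambda>w. g w * indicator {x<..} w) \<le> exp (- x\<^sup>2 / 2) * normal_expect (\<lambda>w. g (x + w))"
proof -
  \<comment> \<open>Tilting by \<open>- x\<close> moves the origin to \<open>x\<close>: the Gaussian
    weight on \<open>{x<..}\<close> becomes \<open>exp (- x\<^sup>2 / 2)\<close> times
    \<open>exp (- x * w)\<close> with \<open>w > 0\<close>, and the last factor is at most
    1.\<close>
  have "normal_expect (\<lambda>w. g w * indicator {x<..} w) =
      normal_expect (\<lambda>w. g (x + w) * indicator {x<..} (x + w) * exp (- x * w - x\<^sup>2 / 2))"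
    using normal_expect_tilt[of "\<lambda>w. g (x + w) * indicator {x<..} (x + w)" "- x"] by simp
  also have "\<dots> \<le> normal_expect (\<lambda>w. exp (- x\<^sup>2 / 2) * g (x + w))"
  proof (rule normal_expect_mono)
    show "integrable std_normal_distribution (\<lambda>w. exp (- x\<^sup>2 / 2) * g (x + w))" using int by simp
    show "0 \<le> exp (- x\<^sup>2 / 2) * g (x + w)" for w using assms by simp
    show "g (x + w) * indicator {x<..} (x + w) * exp (- x * w - x\<^sup>2 / 2) \<le> exp (- x\<^sup>2 / 2) * g (x + w)" for w
      using assms by (auto simp: indicator_def mult.commute intro!: mult_left_mono)
  qed
  also have "\<dots> = exp (- x\<^sup>2 / 2) * normal_expect (\<lambda>w. g (x + w))"
    by (simp add: normal_expect_def)
  finally show ?thesis .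
qed

lemma normal_upper_tail:
  "x \<ge> 0 \<Longrightarrow> normal_expect (indicator {x<..}) \<le> exp (- x\<^sup>2 / 2)"
  using normal_expect_upper_tail[of "\<lambda>_. 1" x] by simp

text \<open>For \<open>x \<ge> 0\<close> the truncation turns the bound into the trivial 1. Both
  signs occur later, where \<open>x\<close> is a positive multiple of
  \<open>a - sqrt r\<close>.\<close>

lemma normal_lower_tail:
  "normal_expect (indicator {..x}) \<le> exp (- (max 0 (- x))\<^sup>2 / 2)"
proof (cases "x < 0")
  case True
  have "normal_expect (indicator {..x}) = (\<integral>w. std_normal_density w * indicator {..x} w \<partial>lborel)"
    by (simp add: normal_expect_lborel)
  \<comment> \<open>Dropping the endpoint, a null set, lets the reflection land exactly on the open
    half-line \<open>{-x<..}\<close>.\<close>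
  also have "\<dots> = (\<integral>w. std_normal_density w * indicator {..<x} w \<partial>lborel)"
    by (rule integral_cong_AE) (auto intro!: AE_I[where N = "{x}"] simp: indicator_def)
  also have "\<dots> = normal_expect (indicator {..<x})"
    by (simp add: normal_expect_lborel)
  also have "\<dots> = normal_expect (\<lambda>w. indicator {-x<..} (- w))"
    by (intro arg_cong[where f = normal_expect]) (auto simp: indicator_def)
  also have "\<dots> = normal_expect (indicator {-x<..})" by (rule normal_expect_uminus) simp
  finally show ?thesis using normal_upper_tail[of "- x"] True by (simp add: max_def)
next
  case False
  have "normal_expect (indicator {..x}) \<le> normal_expect (\<lambda>_. 1)"
    by (rule normal_expect_mono) (auto simp: indicator_def)
  with False show ?thesis by (simp add: max_absorb1)
qed

text \<open>The density decreases on the nonnegative half-line, so on an interval of length 1 it is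
  at least its value at the right end.\<close>

lemma normal_unit_interval:
  assumes "x \<ge> 0"
  shows "std_normal_density (x + 1) \<le> normal_expect (indicator {x..x + 1})"
proof -
  have "std_normal_density (x + 1) = (\<integral>w. std_normal_density (x + 1) * indicator {x..x + 1} w \<partial>lborel)"
    by simp
  also have "\<dots> \<le> (\<integral>w. std_normal_density w * indicator {x..x + 1} w \<partial>lborel)"
  proof (rule integral_mono')
    have "integrable std_normal_distribution (indicat_real {x..x + 1})"
      using integrable_normal_indicator[of "{x..x + 1}" 0] by simp
    then show "integrable lborel (\<lambda>w. std_normal_density w * indicator {x..x + 1} w)"
      by (simp add: integrable_std_normal_iff)
    show "std_normal_density (x + 1) * indicator {x..x + 1} w \<le> std_normal_density w * indicator {x..x + 1} w" for w
      using assms by (auto simp: indicator_def std_normal_density_def intro!: divide_right_mono power_mono)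
  qed simp
  also have "\<dots> = normal_expect (indicator {x..x + 1})" by (simp add: normal_expect_lborel)
  finally show ?thesis .
qed

text \<open>Since \<open>\<theta> \<ge> 0\<close>, each way for \<open>\<theta> + w\<close> to leave
  \<open>[-t, t]\<close> forces \<open>w\<close> beyond distance \<open>t - \<theta>\<close> from 0.
  The weight is dominated by an even function \<open>g\<close>, so both tails contribute equally and
  the one-sided bound applies to each.\<close>

lemma normal_two_sided_tail:
  assumes "0 \<le> \<theta>" "\<theta> \<le> t"
  shows "normal_expect (\<lambda>w. (1 + \<bar>\<theta> + w\<bar>)\<^sup>2 * indicator {t<..} \<bar>\<theta> + w\<bar>)
    \<le> 4 * ((1 + t)\<^sup>2 + 1) * exp (- (t - \<theta>)\<^sup>2 / 2)"
proof -
  define x where "x = t - \<theta>"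
  define g where "g = (\<lambda>w. (1 + \<theta> + \<bar>w\<bar>)\<^sup>2 :: real)"
  have [measurable]: "g \<in> borel_measurable borel" by (simp add: g_def)
  have x: "x \<ge> 0" using assms by (simp add: x_def)
  have g_bound: "\<bar>g z\<bar> \<le> (1 + \<theta>)\<^sup>2 * (1 + \<bar>z\<bar>)\<^sup>2" for z
  proof -
    have "1 + \<theta> + \<bar>z\<bar> \<le> (1 + \<theta>) * (1 + \<bar>z\<bar>)" using assms by (simp add: algebra_simps)
    then have "g z \<le> ((1 + \<theta>) * (1 + \<bar>z\<bar>))\<^sup>2" unfolding g_def using assms by (intro power_mono) auto
    then show ?thesis by (simp add: g_def power_mult_distrib)
  qed
  have int_ind: "integrable std_normal_distribution (\<lambda>w. g (0 + w) * indicator S (0 + w))"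
    if [measurable]: "S \<in> sets borel" for S
    by (rule integrable_normal_growth[where K = "(1 + \<theta>)\<^sup>2" and f = "\<lambda>w. g w * indicator S w"])
       (use g_bound in \<open>auto simp: indicator_def\<close>)
  have int_right: "integrable std_normal_distribution (\<lambda>w. g w * indicator {x<..} w)"
    using int_ind[of "{x<..}"] by simp
  have "(\<lambda>w. g w * indicator {..<-x} w) = (\<lambda>w. g (- w) * indicator {x<..} (- w))"
    by (auto simp: indicator_def g_def fun_eq_iff)
  then have int_left: "integrable std_normal_distribution (\<lambda>w. g (- w) * indicator {x<..} (- w))"
    using int_ind[of "{..<-x}"] by simp
  have int_g: "integrable std_normal_distribution (\<lambda>w. g (x + w))"
    using g_bound by (intro integrable_normal_growth) auto
  have g2: "normal_expect (\<lambda>w. g (x + w)) \<le> 2 * ((1 + t)\<^sup>2 + 1)"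
  proof -
    have "normal_expect (\<lambda>w. g (x + w)) \<le> normal_expect (\<lambda>w. 2 * (1 + t)\<^sup>2 + 2 * w\<^sup>2)"
    proof (rule normal_expect_mono)
      show "integrable std_normal_distribution (\<lambda>w. 2 * (1 + t)\<^sup>2 + 2 * w\<^sup>2)"
        using integrable_std_normal_distribution_moment[of 2] by auto
      fix w
      \<comment> \<open>The shift \<open>x = t - \<theta>\<close> absorbs \<open>\<theta>\<close>:
        \<open>1 + \<theta> + \<bar>x + w\<bar> \<le> 1 + t + \<bar>w\<bar>\<close>.\<close>
      have "g (x + w) \<le> ((1 + t) + \<bar>w\<bar>)\<^sup>2" unfolding g_def x_def using assms by (intro power_mono) auto
      also have "\<dots> \<le> 2 * (1 + t)\<^sup>2 + 2 * w\<^sup>2"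
        using sum_squares_bound[of "1 + t" "\<bar>w\<bar>"] by (simp add: power2_sum)
      finally show "g (x + w) \<le> 2 * (1 + t)\<^sup>2 + 2 * w\<^sup>2" .
    qed auto
    also have "\<dots> = 2 * (1 + t)\<^sup>2 + 2 * normal_expect (\<lambda>w. w\<^sup>2)"
      using integrable_std_normal_distribution_moment[of 2] normal_expect_const[of "2 * (1 + t)\<^sup>2"]
      unfolding normal_expect_def by (subst Bochner_Integration.integral_add) auto
    finally show ?thesis by (simp add: normal_expect_square)
  qed
  have "normal_expect (\<lambda>w. (1 + \<bar>\<theta> + w\<bar>)\<^sup>2 * indicator {t<..} \<bar>\<theta> + w\<bar>)
      \<le> normal_expect (\<lambda>w. g w * indicator {x<..} w + g (- w) * indicator {x<..} (- w))"
  proof (rule normal_expect_mono)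
    show "integrable std_normal_distribution (\<lambda>w. g w * indicator {x<..} w + g (- w) * indicator {x<..} (- w))"
      using int_right int_left by (rule Bochner_Integration.integrable_add)
    fix w
    show "0 \<le> g w * indicator {x<..} w + g (- w) * indicator {x<..} (- w)" by (simp add: g_def)
    have "(1 + \<bar>\<theta> + w\<bar>)\<^sup>2 \<le> g w" "g (- w) = g w"
      unfolding g_def using assms by (auto intro!: power_mono)
    then show "(1 + \<bar>\<theta> + w\<bar>)\<^sup>2 * indicator {t<..} \<bar>\<theta> + w\<bar>
        \<le> g w * indicator {x<..} w + g (- w) * indicator {x<..} (- w)"
      using assms by (auto simp: indicator_def x_def g_def)
  qed
  also have "\<dots> = normal_expect (\<lambda>w. g w * indicator {x<..} w) + normal_expect (\<lambda>w. g (- w) * indicator {x<..} (- w))"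
    unfolding normal_expect_def using int_right int_left by (rule Bochner_Integration.integral_add)
  also have "normal_expect (\<lambda>w. g (- w) * indicator {x<..} (- w)) = normal_expect (\<lambda>w. g w * indicator {x<..} w)"
    using normal_expect_uminus[of "\<lambda>w. g w * indicator {x<..} w"] by simp
  also have "normal_expect (\<lambda>w. g w * indicator {x<..} w) + normal_expect (\<lambda>w. g w * indicator {x<..} w)
      \<le> 2 * (exp (- x\<^sup>2 / 2) * normal_expect (\<lambda>w. g (x + w)))"
    using normal_expect_upper_tail[OF _ int_g] x by (simp add: g_def)
  also have "\<dots> \<le> 2 * (exp (- x\<^sup>2 / 2) * (2 * ((1 + t)\<^sup>2 + 1)))"
    using g2 by (intro mult_left_mono) auto
  also have "\<dots> = 4 * ((1 + t)\<^sup>2 + 1) * exp (- x\<^sup>2 / 2)" by (simp add: algebra_simps)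
  finally show ?thesis by (simp only: x_def)
qed

text \<open>Without a cut, Cauchy-Schwarz charges the full second moment
  \<open>exp (\<tau>\<^sup>2)\<close> of the likelihood ratio, which only reaches
  \<open>r < \<beta> - 1/2\<close>. That second moment is concentrated around
  \<open>2 * \<tau>\<close>; cutting at \<open>s\<close> can remove it, at the price of a term with
  the second moment under the shifted law and the probability of exceeding \<open>s\<close>.\<close>

lemma normal_expect_shift_split:
  assumes [measurable]: "h \<in> borel_measurable borel"
    and bound: "\<And>z. \<bar>h z\<bar> \<le> 1 + \<bar>z\<bar>"
  shows "normal_expect (\<lambda>w. h (\<tau> + w)) \<le>
    sqrt (normal_expect (\<lambda>w. (h w)\<^sup>2)) * (exp (\<tau>\<^sup>2 / 2) * sqrt (normal_expect (\<lambda>w. indicator {..s} (2 * \<tau> + w))))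
    + sqrt (normal_expect (\<lambda>w. (h (\<tau> + w))\<^sup>2)) * sqrt (normal_expect (\<lambda>w. indicator {s<..} (\<tau> + w)))"
proof -
  have bound2: "\<bar>(h z)\<^sup>2\<bar> \<le> 1 * (1 + \<bar>z\<bar>)\<^sup>2" for z
    using power_mono[OF bound[of z], of 2] by simp
  have bound1: "\<bar>h z\<bar> \<le> 1 * (1 + \<bar>z\<bar>)\<^sup>2" for z
  proof -
    have "(1 + \<bar>z\<bar>) ^ 1 \<le> (1 + \<bar>z\<bar>)\<^sup>2" by (rule power_increasing) auto
    then show ?thesis using bound[of z] by simp
  qed
  have int2: "integrable std_normal_distribution (\<lambda>w. (h (\<theta> + w))\<^sup>2)" for \<theta>
    by (rule integrable_normal_growth[where f = "\<lambda>z. (h z)\<^sup>2" and K = 1]) (simp, rule bound2)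
  have int_part: "integrable std_normal_distribution (\<lambda>w. h (\<tau> + w) * indicator S (\<tau> + w))"
    if [measurable]: "S \<in> sets borel" for S
    using bound1 by (intro integrable_normal_growth[where f = "\<lambda>z. h z * indicator S z" and K = 1])
      (auto simp: indicator_def)
  have ind_sq: "(indicat_real {s<..} z)\<^sup>2 = indicat_real {s<..} z" for z
    by (simp add: indicator_def)
  define e where "e = (\<lambda>w. indicator {..s} w * exp (\<tau> * w - \<tau>\<^sup>2 / 2) :: real)"
  have [measurable]: "e \<in> borel_measurable borel" by (simp add: e_def)
  \<comment> \<open>The square of the tilt by \<open>\<tau>\<close> is
    \<open>exp (\<tau>\<^sup>2)\<close> times the tilt by \<open>2 * \<tau>\<close>; this is the
    origin of the doubled shift in the first term.\<close>
  have e2: "(e w)\<^sup>2 = exp (\<tau>\<^sup>2) * (indicator {..s} w * exp ((2 * \<tau>) * w - (2 * \<tau>)\<^sup>2 / 2))" for w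
    by (auto simp: e_def indicator_def power2_eq_square exp_add[symmetric] field_simps)
  have int_e: "integrable std_normal_distribution (\<lambda>w. (e w)\<^sup>2)"
    unfolding e2 using integrable_normal_indicator[of "{..s}" "2 * \<tau>"]
    by (simp add: integrable_normal_tilt[of "indicat_real {..s}" "2 * \<tau>"])
  have "normal_expect (\<lambda>w. h (\<tau> + w)) =
      normal_expect (\<lambda>w. h (\<tau> + w) * indicator {..s} (\<tau> + w) + h (\<tau> + w) * indicator {s<..} (\<tau> + w))"
    by (intro arg_cong[where f = normal_expect]) (auto simp: indicator_def)
  also have "\<dots> = normal_expect (\<lambda>w. h (\<tau> + w) * indicator {..s} (\<tau> + w))
      + normal_expect (\<lambda>w. h (\<tau> + w) * indicator {s<..} (\<tau> + w))"
    unfolding normal_expect_def using int_part by (intro Bochner_Integration.integral_add) auto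
  also have "normal_expect (\<lambda>w. h (\<tau> + w) * indicator {..s} (\<tau> + w)) = normal_expect (\<lambda>w. h w * e w)"
    using normal_expect_tilt[of "\<lambda>z. h z * indicator {..s} z" \<tau>] by (simp add: e_def mult.assoc)
  also have "\<dots> \<le> sqrt (normal_expect (\<lambda>w. (h w)\<^sup>2)) * sqrt (normal_expect (\<lambda>w. (e w)\<^sup>2))"
    unfolding normal_expect_def using int2[of 0] int_e by (intro cauchy_schwarz_integral) auto
  also have "normal_expect (\<lambda>w. (e w)\<^sup>2) = exp (\<tau>\<^sup>2) * normal_expect (\<lambda>w. indicator {..s} (2 * \<tau> + w))"
    unfolding e2 using normal_expect_tilt[of "indicator {..s}" "2 * \<tau>"] by (simp add: normal_expect_def)
  also have "sqrt (exp (\<tau>\<^sup>2) * normal_expect (\<lambda>w. indicator {..s} (2 * \<tau> + w))) =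
      exp (\<tau>\<^sup>2 / 2) * sqrt (normal_expect (\<lambda>w. indicator {..s} (2 * \<tau> + w)))"
  proof -
    have "sqrt (exp (\<tau>\<^sup>2)) = exp (\<tau>\<^sup>2 / 2)"
      by (rule real_sqrt_unique) (auto simp: power2_eq_square exp_add[symmetric])
    then show ?thesis by (simp add: real_sqrt_mult)
  qed
  also have "normal_expect (\<lambda>w. h (\<tau> + w) * indicator {s<..} (\<tau> + w)) \<le>
     sqrt (normal_expect (\<lambda>w. (h (\<tau> + w))\<^sup>2)) * sqrt (normal_expect (\<lambda>w. (indicator {s<..} (\<tau> + w))\<^sup>2))"
  proof -
    have "integrable std_normal_distribution (\<lambda>w. (indicat_real {s<..} (\<tau> + w))\<^sup>2)"
      using integrable_normal_indicator[of "{s<..}" \<tau>] by (simp add: ind_sq)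
    then show ?thesis
      unfolding normal_expect_def using int2 by (intro cauchy_schwarz_integral) auto
  qed
  finally show ?thesis by (simp add: ind_sq)
qed

section \<open>Moments, proxy separation and optimal threshold of an abstract threshold rule\<close>

locale threshold_rule =
  fixes \<eta> :: "real \<Rightarrow> real \<Rightarrow> real"
  assumes measurable_eta [measurable]: "\<eta> t \<in> borel_measurable borel"
    and odd: "\<eta> t (- z) = - \<eta> t z"
    and mono: "t \<ge> 0 \<Longrightarrow> z \<le> z' \<Longrightarrow> \<eta> t z \<le> \<eta> t z'"
    and eq_0: "t \<ge> 0 \<Longrightarrow> \<bar>z\<bar> \<le> t \<Longrightarrow> \<eta> t z = 0"
    and ge_1: "t \<ge> 0 \<Longrightarrow> z \<ge> t + 1 \<Longrightarrow> \<eta> t z \<ge> 1"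
    and growth: "t \<ge> 0 \<Longrightarrow> \<bar>\<eta> t z\<bar> \<le> 1 + \<bar>z\<bar>"
    and cont: "t \<noteq> \<bar>z\<bar> \<Longrightarrow> isCont (\<lambda>t. \<eta> t z) t"
begin

lemma growth_square: "t \<ge> 0 \<Longrightarrow> \<bar>\<eta> t z ^ k\<bar> \<le> 1 * (1 + \<bar>z\<bar>)\<^sup>2" if "k \<le> 2"
proof -
  assume "t \<ge> 0"
  then have "\<bar>\<eta> t z ^ k\<bar> \<le> (1 + \<bar>z\<bar>) ^ k" unfolding power_abs by (intro power_mono growth) auto
  also have "\<dots> \<le> (1 + \<bar>z\<bar>)\<^sup>2" using that by (intro power_increasing) auto
  finally show ?thesis by simp
qed

lemma integrable_power: "k \<le> 2 \<Longrightarrow> t \<ge> 0 \<Longrightarrow> integrable std_normal_distribution (\<lambda>w. \<eta> t (\<theta> + w) ^ k)"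
  by (rule integrable_normal_growth[where f = "\<lambda>z. \<eta> t z ^ k" and K = 1]) (simp, rule growth_square)

lemma integrable_eta: "t \<ge> 0 \<Longrightarrow> integrable std_normal_distribution (\<lambda>w. \<eta> t (\<theta> + w))"
  using integrable_power[of 1] by simp

text \<open>Dominated convergence with a quadratic majorant. By \<open>cont\<close>, pointwise
  convergence can fail only where \<open>\<bar>\<theta> + w\<bar> = t\<close>, that is at two values
  of \<open>w\<close>, so the jumps of clipping and hard thresholding do no harm. The powers 1 and 2
  give numerator and denominator of the separation.\<close>

lemma continuous_on_normal_expect:
  assumes "k \<le> 2"
  shows "continuous_on {0..} (\<lambda>t. normal_expect (\<lambda>w. \<eta> t (\<theta> + w) ^ k))"
  unfolding continuous_on_sequentially
proof (intro allI ballI impI)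
  fix u t assume t: "t \<in> {0..}" and "(\<forall>n. u n \<in> {0::real..}) \<and> u \<longlonglongrightarrow> t"
  then have u: "\<And>n. u n \<ge> 0" "u \<longlonglongrightarrow> t" by auto
  show "((\<lambda>t. normal_expect (\<lambda>w. \<eta> t (\<theta> + w) ^ k)) \<circ> u) \<longlonglongrightarrow> normal_expect (\<lambda>w. \<eta> t (\<theta> + w) ^ k)"
    unfolding normal_expect_def comp_def
  proof (rule integral_dominated_convergence)
    show "integrable std_normal_distribution (\<lambda>w. (1 + \<bar>\<theta> + w\<bar>)\<^sup>2)"
      by (rule integrable_normal_growth[where f = "\<lambda>z. (1 + \<bar>z\<bar>)\<^sup>2" and K = 1]) auto
    show "AE w in std_normal_distribution. norm (\<eta> (u n) (\<theta> + w) ^ k) \<le> (1 + \<bar>\<theta> + w\<bar>)\<^sup>2" for n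
      using growth_square[OF assms u(1)] by simp
    have "AE w in lborel. w \<notin> {t - \<theta>, - t - \<theta>}"
      by (intro AE_not_in finite_imp_null_set_lborel) auto
    then have "AE w in std_normal_distribution. w \<notin> {t - \<theta>, - t - \<theta>}"
      by (subst AE_density) auto
    then show "AE w in std_normal_distribution. (\<lambda>n. \<eta> (u n) (\<theta> + w) ^ k) \<longlonglongrightarrow> \<eta> t (\<theta> + w) ^ k"
    proof eventually_elim
      fix w assume "w \<notin> {t - \<theta>, - t - \<theta>}"
      then have "t \<noteq> \<bar>\<theta> + w\<bar>" by (auto simp: abs_if)
      from isCont_tendsto_compose[OF cont[OF this] u(2)]
      show "(\<lambda>n. \<eta> (u n) (\<theta> + w) ^ k) \<longlonglongrightarrow> \<eta> t (\<theta> + w) ^ k" by (rule tendsto_power)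
    qed
  qed auto
qed

text \<open>The integrand takes both signs, so it cannot simply be restricted to an interval.
  Oddness and the reflection of \<open>w\<close> write twice the mean as the expectation of
  \<open>\<eta> t (\<tau> + w) - \<eta> t (w - \<tau>)\<close>, which is nonnegative by monotonicity
  and at least 1 on a unit interval.\<close>

lemma mean_lower:
  assumes "t \<ge> 0" "\<tau> \<ge> 1" "\<tau> \<le> t + 1"
  shows "std_normal_density (t + 2 - \<tau>) / 2 \<le> normal_expect (\<lambda>w. \<eta> t (\<tau> + w))"
proof -
  have int: "integrable std_normal_distribution (\<lambda>w. \<eta> t (\<tau> + w))"
    "integrable std_normal_distribution (\<lambda>w. \<eta> t (w - \<tau>))"
    using integrable_eta[OF assms(1), of \<tau>] integrable_eta[OF assms(1), of "- \<tau>"] by simp_all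
  have "normal_expect (\<lambda>w. \<eta> t (\<tau> + w)) = normal_expect (\<lambda>w. \<eta> t (\<tau> + - w))"
    using normal_expect_uminus[of "\<lambda>w. \<eta> t (\<tau> + w)"] by simp
  also have "\<dots> = normal_expect (\<lambda>w. - \<eta> t (w - \<tau>))"
    by (intro arg_cong[where f = normal_expect]) (simp add: odd[symmetric])
  finally have refl: "normal_expect (\<lambda>w. \<eta> t (\<tau> + w)) = - normal_expect (\<lambda>w. \<eta> t (w - \<tau>))"
    by (simp add: normal_expect_def)
  have "std_normal_density (t + 1 - \<tau> + 1) \<le> normal_expect (indicator {t + 1 - \<tau>..t + 1 - \<tau> + 1})"
    using assms by (intro normal_unit_interval) auto
  also have "\<dots> \<le> normal_expect (\<lambda>w. \<eta> t (\<tau> + w) - \<eta> t (w - \<tau>))"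
  proof (rule normal_expect_mono)
    show "integrable std_normal_distribution (\<lambda>w. \<eta> t (\<tau> + w) - \<eta> t (w - \<tau>))"
      using int by simp
    show nn: "0 \<le> \<eta> t (\<tau> + w) - \<eta> t (w - \<tau>)" for w
      using assms mono[of t "w - \<tau>" "\<tau> + w"] by simp
    show "indicator {t + 1 - \<tau>..t + 1 - \<tau> + 1} w \<le> \<eta> t (\<tau> + w) - \<eta> t (w - \<tau>)" for w
    proof (cases "w \<in> {t + 1 - \<tau>..t + 1 - \<tau> + 1}")
      case True
      then have "\<eta> t (\<tau> + w) \<ge> 1" using assms by (intro ge_1) auto
      \<comment> \<open>On the interval \<open>w - \<tau> \<le> t + 2 - 2 * \<tau>\<close>, and this
        is at most \<open>t\<close> because \<open>\<tau> \<ge> 1\<close>.\<close>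
      moreover have "\<eta> t (w - \<tau>) \<le> \<eta> t t" using True assms by (intro mono) auto
      ultimately show ?thesis using True eq_0[of t t] assms by simp
    qed (use nn in simp)
  qed
  also have "\<dots> = 2 * normal_expect (\<lambda>w. \<eta> t (\<tau> + w))"
    using int refl by (simp add: normal_expect_def)
  finally show ?thesis by (simp add: algebra_simps)
qed

lemma square_expect_lower:
  assumes "t \<ge> 0"
  shows "std_normal_density (t + 2) \<le> normal_expect (\<lambda>w. (\<eta> t w)\<^sup>2)"
proof -
  have "std_normal_density (t + 1 + 1) \<le> normal_expect (indicator {t + 1..t + 1 + 1})"
    using assms by (intro normal_unit_interval) auto
  also have "\<dots> \<le> normal_expect (\<lambda>w. (\<eta> t w)\<^sup>2)"
  proof (rule normal_expect_mono)
    show "integrable std_normal_distribution (\<lambda>w. (\<eta> t w)\<^sup>2)"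
      using integrable_power[of 2 t 0] assms by simp
    show "indicator {t + 1..t + 1 + 1} w \<le> (\<eta> t w)\<^sup>2" for w
      using ge_1[OF assms, of w] one_le_power[of "\<eta> t w" 2] by (auto simp: indicator_def)
  qed auto
  finally show ?thesis by (simp add: algebra_simps)
qed

lemma square_expect_upper:
  assumes "0 \<le> \<theta>" "\<theta> \<le> t"
  shows "normal_expect (\<lambda>w. (\<eta> t (\<theta> + w))\<^sup>2) \<le> 4 * ((1 + t)\<^sup>2 + 1) * exp (- (t - \<theta>)\<^sup>2 / 2)"
proof -
  have "normal_expect (\<lambda>w. (\<eta> t (\<theta> + w))\<^sup>2) \<le> normal_expect (\<lambda>w. (1 + \<bar>\<theta> + w\<bar>)\<^sup>2 * indicator {t<..} \<bar>\<theta> + w\<bar>)"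
  proof (rule normal_expect_mono)
    show "integrable std_normal_distribution (\<lambda>w. (1 + \<bar>\<theta> + w\<bar>)\<^sup>2 * indicator {t<..} \<bar>\<theta> + w\<bar>)"
      by (rule integrable_normal_growth[where f = "\<lambda>z. (1 + \<bar>z\<bar>)\<^sup>2 * indicator {t<..} \<bar>z\<bar>" and K = 1])
        (auto simp: indicator_def)
    show "(\<eta> t (\<theta> + w))\<^sup>2 \<le> (1 + \<bar>\<theta> + w\<bar>)\<^sup>2 * indicator {t<..} \<bar>\<theta> + w\<bar>" for w
      using growth_square[of 2 t "\<theta> + w"] eq_0[of t "\<theta> + w"] assms by (auto simp: indicator_def)
  qed auto
  also have "\<dots> \<le> 4 * ((1 + t)\<^sup>2 + 1) * exp (- (t - \<theta>)\<^sup>2 / 2)"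
    using assms by (rule normal_two_sided_tail)
  finally show ?thesis .
qed

lemma sep_denom_pos:
  assumes "0 \<le> \<epsilon>" "\<epsilon> < 1" "t \<ge> 0"
  shows "sep_denom \<eta> \<epsilon> \<tau> t > 0"
proof -
  have "0 < std_normal_density (t + 2)" by (simp add: normal_density_pos)
  then have "normal_expect (\<lambda>w. (\<eta> t w)\<^sup>2) > 0" using square_expect_lower[OF assms(3)] by linarith
  moreover have "normal_expect (\<lambda>w. (\<eta> t (\<tau> + w))\<^sup>2) \<ge> 0" by (simp add: normal_expect_def)
  ultimately show ?thesis using assms by (simp add: sep_denom_def add_nonneg_pos)
qed

lemma sqrt_sep_denom_ge:
  assumes "0 < \<epsilon>" "\<epsilon> < 1"
  shows "sqrt (1 - \<epsilon>) * sqrt (normal_expect (\<lambda>w. (\<eta> t w)\<^sup>2)) \<le> sqrt (sep_denom \<eta> \<epsilon> \<tau> t)"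
    and "sqrt \<epsilon> * sqrt (normal_expect (\<lambda>w. (\<eta> t (\<tau> + w))\<^sup>2)) \<le> sqrt (sep_denom \<eta> \<epsilon> \<tau> t)"
  using assms by (simp_all add: sep_denom_def normal_expect_def flip: real_sqrt_mult)

text \<open>Each root second moment is at most the root of \<open>sep_denom\<close>, divided by
  \<open>sqrt (1 - \<epsilon>)\<close> or \<open>sqrt \<epsilon>\<close>, so it cancels against the
  denominator of the separation. Only the factors \<open>X\<close> and \<open>Y\<close>
  survive.\<close>

lemma proxy_sep_le:
  assumes "0 < \<epsilon>" "\<epsilon> < 1" "\<tau> \<ge> 0" "t \<ge> 0" "X \<ge> 0" "Y \<ge> 0"
    and le: "normal_expect (\<lambda>w. \<eta> t (\<tau> + w)) \<le>
      sqrt (normal_expect (\<lambda>w. (\<eta> t w)\<^sup>2)) * X + sqrt (normal_expect (\<lambda>w. (\<eta> t (\<tau> + w))\<^sup>2)) * Y"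
  shows "proxy_sep \<eta> \<epsilon> \<tau> t \<le> 2 * \<epsilon> * \<tau> * (X / sqrt (1 - \<epsilon>) + Y / sqrt \<epsilon>)"
proof -
  define D where "D = sqrt (sep_denom \<eta> \<epsilon> \<tau> t)"
  have "D > 0" using sep_denom_pos assms by (simp add: D_def)
  have "normal_expect (\<lambda>w. \<eta> t (\<tau> + w)) \<le> D / sqrt (1 - \<epsilon>) * X + D / sqrt \<epsilon> * Y"
    using assms sqrt_sep_denom_ge[OF assms(1,2), of t \<tau>]
    by (intro order_trans[OF le] add_mono mult_right_mono) (auto simp: D_def field_simps)
  then have "2 * (\<epsilon> * \<tau> * normal_expect (\<lambda>w. \<eta> t (\<tau> + w))) \<le>
      2 * (\<epsilon> * \<tau> * (D / sqrt (1 - \<epsilon>) * X + D / sqrt \<epsilon> * Y))"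
    using assms by (intro mult_left_mono) auto
  also have "\<dots> = 2 * \<epsilon> * \<tau> * (X / sqrt (1 - \<epsilon>) + Y / sqrt \<epsilon>) * D" by (simp add: algebra_simps)
  finally show ?thesis using \<open>D > 0\<close>
    by (simp add: proxy_sep_def sep_numer_def D_def[symmetric] pos_divide_le_eq)
qed

text \<open>The right-hand side is free of \<open>t\<close>, so it holds at the ideal threshold
  wherever that lies; the cut \<open>s\<close> is still to be chosen.\<close>

lemma proxy_sep_le_split:
  assumes "0 < \<epsilon>" "\<epsilon> < 1" "\<tau> \<ge> 0" "t \<ge> 0"
  shows "proxy_sep \<eta> \<epsilon> \<tau> t \<le> 2 * \<epsilon> * \<tau> *
    (exp (\<tau>\<^sup>2 / 2) * sqrt (normal_expect (\<lambda>w. indicator {..s} (2 * \<tau> + w))) / sqrt (1 - \<epsilon>)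
      + sqrt (normal_expect (\<lambda>w. indicator {s<..} (\<tau> + w))) / sqrt \<epsilon>)"
  using assms growth by (intro proxy_sep_le normal_expect_shift_split) (auto simp: normal_expect_def)

text \<open>Serves to show that the separation vanishes as \<open>t\<close> grows with
  \<open>\<epsilon>\<close> and \<open>\<tau>\<close> fixed, which confines the search for a
  maximiser to a compact interval. As \<open>\<eta> t\<close> vanishes on \<open>[-t, t]\<close>, an
  indicator of the complement can be inserted before Cauchy-Schwarz.\<close>

lemma proxy_sep_le_tail:
  assumes "0 < \<epsilon>" "\<epsilon> < 1" "\<tau> \<ge> 0" "\<tau> \<le> t"
  shows "proxy_sep \<eta> \<epsilon> \<tau> t \<le> 2 * \<epsilon> * \<tau> * (sqrt (4 * ((1 + t)\<^sup>2 + 1) * exp (- (t - \<tau>)\<^sup>2 / 2)) / sqrt \<epsilon>)"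
proof -
  have t: "t \<ge> 0" using assms by simp
  define I where "I = indicat_real ({t<..} \<union> {..<-t})"
  have [measurable]: "I \<in> borel_measurable borel" by (simp add: I_def)
  have I2: "(I z)\<^sup>2 = I z" for z by (simp add: I_def indicator_def)
  have int_I: "integrable std_normal_distribution (\<lambda>w. I (\<tau> + w))"
    unfolding I_def by (rule integrable_normal_indicator) auto
  have "normal_expect (\<lambda>w. \<eta> t (\<tau> + w)) = normal_expect (\<lambda>w. \<eta> t (\<tau> + w) * I (\<tau> + w))"
  proof (intro arg_cong[where f = normal_expect] ext)
    show "\<eta> t (\<tau> + w) = \<eta> t (\<tau> + w) * I (\<tau> + w)" for w
      using eq_0[OF t, of "\<tau> + w"] by (auto simp: I_def indicator_def abs_le_iff)
  qed
  also have "\<dots> \<le> sqrt (normal_expect (\<lambda>w. (\<eta> t (\<tau> + w))\<^sup>2)) * sqrt (normal_expect (\<lambda>w. (I (\<tau> + w))\<^sup>2))"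
    unfolding normal_expect_def using integrable_power[of 2 t \<tau>] t int_I
    by (intro cauchy_schwarz_integral) (auto simp: I2)
  also have "normal_expect (\<lambda>w. (I (\<tau> + w))\<^sup>2) \<le> normal_expect (\<lambda>w. (1 + \<bar>\<tau> + w\<bar>)\<^sup>2 * indicator {t<..} \<bar>\<tau> + w\<bar>)"
  proof (rule normal_expect_mono)
    show "integrable std_normal_distribution (\<lambda>w. (1 + \<bar>\<tau> + w\<bar>)\<^sup>2 * indicator {t<..} \<bar>\<tau> + w\<bar>)"
      by (rule integrable_normal_growth[where f = "\<lambda>z. (1 + \<bar>z\<bar>)\<^sup>2 * indicator {t<..} \<bar>z\<bar>" and K = 1])
        (auto simp: indicator_def)
    show "(I (\<tau> + w))\<^sup>2 \<le> (1 + \<bar>\<tau> + w\<bar>)\<^sup>2 * indicator {t<..} \<bar>\<tau> + w\<bar>" for w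
      using one_le_power[of "1 + \<bar>\<tau> + w\<bar>" 2] t unfolding I2 by (auto simp: I_def indicator_def)
  qed auto
  also have "\<dots> \<le> 4 * ((1 + t)\<^sup>2 + 1) * exp (- (t - \<tau>)\<^sup>2 / 2)"
    using assms by (intro normal_two_sided_tail) auto
  \<comment> \<open>Only the second moment under the shifted law is used; the product with 0 matches
    \<open>proxy_sep_le\<close> at \<open>X = 0\<close>.\<close>
  finally have "normal_expect (\<lambda>w. \<eta> t (\<tau> + w)) \<le> sqrt (normal_expect (\<lambda>w. (\<eta> t w)\<^sup>2)) * 0 +
      sqrt (normal_expect (\<lambda>w. (\<eta> t (\<tau> + w))\<^sup>2)) * sqrt (4 * ((1 + t)\<^sup>2 + 1) * exp (- (t - \<tau>)\<^sup>2 / 2))"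
    by (simp add: normal_expect_def mult_left_mono)
  from proxy_sep_le[OF assms(1-3) t _ _ this] show ?thesis by simp
qed

lemma proxy_sep_pos:
  assumes "0 < \<epsilon>" "\<epsilon> < 1" "\<tau> \<ge> 1" "t \<ge> 0" "\<tau> \<le> t + 1"
  shows "proxy_sep \<eta> \<epsilon> \<tau> t > 0"
proof -
  have "0 < std_normal_density (t + 2 - \<tau>) / 2" by (simp add: normal_density_pos)
  then have "normal_expect (\<lambda>w. \<eta> t (\<tau> + w)) > 0" using mean_lower[OF assms(4,3,5)] by linarith
  then show ?thesis using assms sep_denom_pos by (simp add: proxy_sep_def sep_numer_def)
qed

lemma continuous_on_proxy_sep:
  assumes "0 \<le> \<epsilon>" "\<epsilon> < 1"
  shows "continuous_on {0..} (proxy_sep \<eta> \<epsilon> \<tau>)"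
proof -
  have "continuous_on {0..} (\<lambda>t. normal_expect (\<lambda>w. \<eta> t (\<tau> + w)))"
    using continuous_on_normal_expect[of 1 \<tau>] by simp
  moreover have "continuous_on {0..} (\<lambda>t. normal_expect (\<lambda>w. (\<eta> t (\<tau> + w))\<^sup>2))"
    using continuous_on_normal_expect[of 2 \<tau>] by simp
  moreover have "continuous_on {0..} (\<lambda>t. normal_expect (\<lambda>w. (\<eta> t w)\<^sup>2))"
    using continuous_on_normal_expect[of 2 0] by simp
  moreover have "sep_denom \<eta> \<epsilon> \<tau> t \<noteq> 0" if "t \<ge> 0" for t
    using sep_denom_pos[OF assms that] by (metis less_irrefl)
  ultimately show ?thesis
    unfolding proxy_sep_def[abs_def] sep_numer_def
    by (intro continuous_intros) (auto simp: sep_denom_def intro!: continuous_intros)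
qed

text \<open>\<open>ARG_MAX\<close> is specified only if a maximiser exists. The separation is
  positive at \<open>\<tau>\<close> and no larger than that value far out, so its maximum over a
  compact interval, attained by continuity, is global.\<close>

lemma ideal_threshold_optimal:
  assumes "0 < \<epsilon>" "\<epsilon> < 1" "\<tau> \<ge> 1"
  shows "ideal_threshold \<eta> \<epsilon> \<tau> \<ge> 0"
    and "\<And>t. t \<ge> 0 \<Longrightarrow> proxy_sep \<eta> \<epsilon> \<tau> t \<le> proxy_sep \<eta> \<epsilon> \<tau> (ideal_threshold \<eta> \<epsilon> \<tau>)"
proof -
  let ?f = "proxy_sep \<eta> \<epsilon> \<tau>"
  have pos: "?f \<tau> > 0" using assms by (intro proxy_sep_pos) auto
  have "((\<lambda>t. 2 * \<epsilon> * \<tau> * (sqrt (4 * ((1 + t)\<^sup>2 + 1) * exp (- (t - \<tau>)\<^sup>2 / 2)) / sqrt \<epsilon>)) \<longlongrightarrow>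
      2 * \<epsilon> * \<tau> * (sqrt 0 / sqrt \<epsilon>)) at_top"
  proof (intro tendsto_intros)
    show "((\<lambda>t. 4 * ((1 + t)\<^sup>2 + 1) * exp (- (t - \<tau>)\<^sup>2 / 2)) \<longlongrightarrow> 0) at_top" by real_asymp
  qed (use assms in auto)
  then have "eventually (\<lambda>t. 2 * \<epsilon> * \<tau> * (sqrt (4 * ((1 + t)\<^sup>2 + 1) * exp (- (t - \<tau>)\<^sup>2 / 2)) / sqrt \<epsilon>) < ?f \<tau>) at_top"
    using pos by (intro order_tendstoD(2)) simp
  then obtain T where T: "\<And>t. t \<ge> T \<Longrightarrow>
      2 * \<epsilon> * \<tau> * (sqrt (4 * ((1 + t)\<^sup>2 + 1) * exp (- (t - \<tau>)\<^sup>2 / 2)) / sqrt \<epsilon>) < ?f \<tau>"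
    unfolding eventually_at_top_linorder by blast
  \<comment> \<open>Taking the maximum with \<open>\<tau>\<close> makes the tail bound valid beyond
    \<open>T'\<close> and puts the comparison point \<open>\<tau>\<close> into
    \<open>{0..T'}\<close>.\<close>
  define T' where "T' = max T \<tau>"
  have far: "?f t \<le> ?f \<tau>" if "t \<ge> T'" for t
    using proxy_sep_le_tail[of \<epsilon> \<tau> t] T[of t] that assms by (simp add: T'_def)
  have "continuous_on {0..T'} ?f"
    using continuous_on_proxy_sep assms by (rule_tac continuous_on_subset[of "{0..}"]) auto
  moreover have "{0..T'} \<noteq> {}" using assms by (simp add: T'_def)
  ultimately obtain x where x: "x \<in> {0..T'}" "\<And>t. t \<in> {0..T'} \<Longrightarrow> ?f t \<le> ?f x"
    using continuous_attains_sup[of "{0..T'}" ?f] by blast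
  have "?f t \<le> ?f x" if "t \<ge> 0" for t
  proof (cases "t \<le> T'")
    case False
    then have "?f t \<le> ?f \<tau>" by (intro far) simp
    also have "\<dots> \<le> ?f x" using assms by (intro x(2)) (auto simp: T'_def)
    finally show ?thesis .
  qed (use that x in auto)
  then have "is_arg_max ?f (\<lambda>t. t \<ge> 0) x" using x(1) by (auto simp: is_arg_max_linorder)
  then have "is_arg_max ?f (\<lambda>t. t \<ge> 0) (ideal_threshold \<eta> \<epsilon> \<tau>)"
    unfolding ideal_threshold_def arg_max_def by (rule someI)
  then show "ideal_threshold \<eta> \<epsilon> \<tau> \<ge> 0"
    and "\<And>t. t \<ge> 0 \<Longrightarrow> proxy_sep \<eta> \<epsilon> \<tau> t \<le> proxy_sep \<eta> \<epsilon> \<tau> (ideal_threshold \<eta> \<epsilon> \<tau>)"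
    by (auto simp: is_arg_max_linorder)
qed

end

section \<open>Clipping, hard and soft thresholding as threshold rules\<close>

lemma isCont_if_less:
  fixes t x :: real and a b :: "'a :: t2_space"
  assumes "t \<noteq> x"
  shows "isCont (\<lambda>s. if x > s then a else b) t"
proof -
  have id: "((\<lambda>s. s) \<longlongrightarrow> t) (nhds t)" by (rule filterlim_ident)
  have "eventually (\<lambda>s. (x > s) = (x > t)) (nhds t)"
  proof (cases "t < x")
    case True
    from order_tendstoD(2)[OF id True] show ?thesis by eventually_elim (use True in simp)
  next
    case False
    with assms have "x < t" by simp
    from order_tendstoD(1)[OF id this] show ?thesis by eventually_elim (use \<open>x < t\<close> in simp)
  qed
  then have "eventually (\<lambda>s. (if x > s then a else b) = (if x > t then a else b)) (nhds t)"
    by eventually_elim simp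
  from isCont_cong[OF this] show ?thesis by simp
qed

lemma threshold_rule_clip: "threshold_rule clip_thresh"
proof
  show "clip_thresh t \<in> borel_measurable borel" for t by (simp add: clip_thresh_def[abs_def])
  show "isCont (\<lambda>t. clip_thresh t z) t" if "t \<noteq> \<bar>z\<bar>" for t z
    unfolding clip_thresh_def using that by (rule isCont_if_less)
qed (auto simp: clip_thresh_def sgn_real_def)

lemma threshold_rule_hard: "threshold_rule hard_thresh"
proof
  show "hard_thresh t \<in> borel_measurable borel" for t by (simp add: hard_thresh_def[abs_def])
  show "isCont (\<lambda>t. hard_thresh t z) t" if "t \<noteq> \<bar>z\<bar>" for t z
    unfolding hard_thresh_def using that by (rule isCont_if_less)
qed (auto simp: hard_thresh_def)

lemma threshold_rule_soft: "threshold_rule soft_thresh"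
proof
  show "soft_thresh t \<in> borel_measurable borel" for t by (simp add: soft_thresh_def[abs_def])
  show "isCont (\<lambda>t. soft_thresh t z) t" for t z
    unfolding soft_thresh_def by (intro continuous_intros)
qed (auto simp: soft_thresh_def sgn_real_def abs_if max_def)

section \<open>Exponents on the two sides of the boundary curve\<close>

lemma rho_star_sqrt_less:
  assumes "0 < \<beta>" "\<beta> < 1" "0 < r" "r < rho_star \<beta>"
  shows "1/2 - \<beta> + r - (max 0 (sqrt r - sqrt (1 - \<beta>)))\<^sup>2 / 2 < 0"
proof -
  define x where "x = sqrt r"
  define b where "b = sqrt (1 - \<beta>)"
  have x: "x > 0" "r = x\<^sup>2" and b: "b > 0" "\<beta> = 1 - b\<^sup>2" using assms by (auto simp: x_def b_def)
  \<comment> \<open>This square equals \<open>(1 - b)\<^sup>2 - (1/2 - b\<^sup>2)\<close>: the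
    linear branch of \<open>rho_star\<close> lies below the curved one and touches it at
    \<open>b = 1/2\<close>, that is \<open>\<beta> = 3/4\<close>.\<close>
  have sq: "2 * (b - 1/2)\<^sup>2 \<ge> 0" by simp
  have key: "x < 1 - b" if "x \<ge> b"
  proof (cases "\<beta> \<le> 3/4")
    case True
    then have "x\<^sup>2 < 1/2 - b\<^sup>2" using assms x b by (auto simp: rho_star_def split: if_splits)
    also have "\<dots> \<le> (1 - b)\<^sup>2" using sq by (simp add: power2_eq_square algebra_simps)
    finally have "x\<^sup>2 < (1 - b)\<^sup>2" .
    moreover have "b \<le> 1" using assms by (simp add: b_def)
    ultimately show ?thesis by (intro power_less_imp_less_base[of x 2]) auto
  next
    case False
    then have "x\<^sup>2 < (1 - b)\<^sup>2" using assms x by (auto simp: rho_star_def b_def split: if_splits)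
    moreover have "b \<le> 1" using assms by (simp add: b_def)
    ultimately show ?thesis by (intro power_less_imp_less_base[of x 2]) auto
  qed
  \<comment> \<open>In these variables the exponent is \<open>((x + b)\<^sup>2 - 1) / 2\<close> for
    \<open>x \<ge> b\<close> and \<open>x\<^sup>2 + b\<^sup>2 - 1/2\<close> for
    \<open>x < b\<close>.\<close>
  have rw: "1/2 - \<beta> + r - (max 0 (sqrt r - sqrt (1 - \<beta>)))\<^sup>2 / 2 = b\<^sup>2 - 1/2 + x\<^sup>2 - (max 0 (x - b))\<^sup>2 / 2"
    unfolding x_def[symmetric] b_def[symmetric] using x(2) b(2) by simp
  show ?thesis
  proof (cases "x \<ge> b")
    case True
    then have "(x + b)\<^sup>2 < 1\<^sup>2" using key b x by (intro power_strict_mono) auto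
    then show ?thesis unfolding rw using True by (simp add: max_def power2_eq_square field_simps)
  next
    case False
    have "x\<^sup>2 < 1/2 - b\<^sup>2"
    proof (cases "\<beta> \<le> 3/4")
      case True
      then show ?thesis using assms x b by (auto simp: rho_star_def split: if_splits)
    next
      case c: False
      have "x\<^sup>2 < b\<^sup>2" using False x by (intro power_strict_mono) auto
      moreover have "b\<^sup>2 < 1/4" using c b by simp
      ultimately show ?thesis by linarith
    qed
    then show ?thesis unfolding rw using False by (simp add: max_def)
  qed
qed

text \<open>At \<open>a = sqrt (1 - \<beta>)\<close> the exponent of the part above the cut is 0 and
  that of the part below is negative. Moving \<open>a\<close> slightly to the right makes the former
  negative and, by continuity, keeps the latter so.\<close>

lemma subcritical_exponent:
  assumes "0 < \<beta>" "\<beta> < 1" "0 < r" "r < rho_star \<beta>"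
  obtains a where "a > 0" "a\<^sup>2 > 1 - \<beta>" "1/2 - \<beta> + r - (max 0 (sqrt r - a))\<^sup>2 / 2 < 0"
proof -
  define b where "b = sqrt (1 - \<beta>)"
  have "((\<lambda>a. 1/2 - \<beta> + r - (max 0 (sqrt r - a))\<^sup>2 / 2) \<longlongrightarrow> 1/2 - \<beta> + r - (max 0 (sqrt r - b))\<^sup>2 / 2) (at_right b)"
    by (intro tendsto_intros) auto
  then have "eventually (\<lambda>a. 1/2 - \<beta> + r - (max 0 (sqrt r - a))\<^sup>2 / 2 < 0) (at_right b)"
    using rho_star_sqrt_less[OF assms] by (intro order_tendstoD(2)) (auto simp: b_def)
  moreover have "eventually (\<lambda>a. a > b) (at_right b)" by (rule eventually_at_right_less)
  ultimately have "eventually (\<lambda>a. a > b \<and> 1/2 - \<beta> + r - (max 0 (sqrt r - a))\<^sup>2 / 2 < 0) (at_right b)"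
    by eventually_elim simp
  then obtain a where a: "a > b" "1/2 - \<beta> + r - (max 0 (sqrt r - a))\<^sup>2 / 2 < 0"
    using eventually_happens'[of "at_right b"] by auto
  have "b > 0" "b\<^sup>2 = 1 - \<beta>" using assms by (auto simp: b_def)
  then have "a\<^sup>2 > 1 - \<beta>" using a power_strict_mono[of b a 2] by simp
  with a \<open>b > 0\<close> show ?thesis by (intro that[of a]) auto
qed

text \<open>The last two conditions say that the lower-bound exponent is positive, one for each
  argument of the minimum: the signal part and the noise part of the denominator.\<close>

lemma supercritical_exponent:
  assumes "0 < \<beta>" "\<beta> < 1" "0 < r" "r > rho_star \<beta>"
  obtains a where "a > 0" "a\<^sup>2 < 1 - \<beta>" "(sqrt r + a)\<^sup>2 > 2 * \<beta> - 1 + 2 * a\<^sup>2"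
proof -
  define x where "x = sqrt r"
  define b where "b = sqrt (1 - \<beta>)"
  have x: "x > 0" "r = x\<^sup>2" and b: "b > 0" "\<beta> = 1 - b\<^sup>2" using assms by (auto simp: x_def b_def)
  have b12: "b < 1/2 \<longleftrightarrow> \<beta> > 3/4"
    unfolding b_def using real_sqrt_less_iff[of "1 - \<beta>" "1/4"] by (simp add: real_sqrt_divide)
  show ?thesis
  proof (cases "x < b")
    case True
    have "\<beta> \<le> 3/4"
    proof (rule ccontr)
      assume c: "\<not> \<beta> \<le> 3/4"
      then have "(1 - b)\<^sup>2 < x\<^sup>2" using assms x by (auto simp: rho_star_def b_def split: if_splits)
      then have "1 - b < x" using x by (intro power_less_imp_less_base[of "1 - b" 2]) auto
      then show False using True b12 c by simp
    qed
    then have "r > \<beta> - 1/2" using assms by (auto simp: rho_star_def split: if_splits)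
    moreover have "x\<^sup>2 < b\<^sup>2" using True x by (intro power_strict_mono) auto
    ultimately show ?thesis using x b
      \<comment> \<open>The quantity \<open>(x + a)\<^sup>2 - 2 * a\<^sup>2\<close> is largest at
        \<open>a = x\<close>, with value \<open>2 * r\<close>; this choice is admissible as
        \<open>x < b\<close>, and the threshold is then \<open>2 * \<tau>\<close>.\<close>
      by (intro that[of x]) (auto simp: x_def[symmetric] power2_eq_square algebra_simps)
  next
    case False
    have sum: "x + b > 1"
    proof (cases "\<beta> \<le> 3/4")
      case True
      then have "b \<ge> 1/2" using b12 by simp
      \<comment> \<open>From \<open>x \<ge> b \<ge> 1/2\<close> follows
        \<open>x + b \<ge> 1\<close>, with equality only at the junction
        \<open>\<beta> = 3/4\<close>, \<open>r = 1/4\<close>, which lies on the curve and is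
        excluded.\<close>
      moreover have "x \<noteq> b \<or> b \<noteq> 1/2"
      proof (rule ccontr)
        assume "\<not> (x \<noteq> b \<or> b \<noteq> 1/2)"
        then have xb: "x = 1/2" "b = 1/2" by auto
        have "r = 1/4" "\<beta> = 3/4" unfolding x(2) b(2) xb by (simp_all add: power2_eq_square)
        then show False using assms by (simp add: rho_star_def)
      qed
      ultimately show ?thesis using False by linarith
    next
      case c: False
      then have "(1 - b)\<^sup>2 < x\<^sup>2" using assms x by (auto simp: rho_star_def b_def split: if_splits)
      then have "1 - b < x" using x by (intro power_less_imp_less_base[of "1 - b" 2]) auto
      then show ?thesis by simp
    qed
    then have "(x + b)\<^sup>2 > 1\<^sup>2" by (intro power_strict_mono) auto
    then have at_b: "(x + b)\<^sup>2 - 2 * b\<^sup>2 > 2 * \<beta> - 1" using b by simp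
    \<comment> \<open>The constraint \<open>a < b\<close> is now the binding one;
      \<open>a = b\<close> gives the noise condition strictly, so some \<open>a\<close> just below
      \<open>b\<close> meets both.\<close>
    have "((\<lambda>a. (x + a)\<^sup>2 - 2 * a\<^sup>2) \<longlongrightarrow> (x + b)\<^sup>2 - 2 * b\<^sup>2) (at_left b)"
      by (intro tendsto_intros)
    then have "eventually (\<lambda>a. (x + a)\<^sup>2 - 2 * a\<^sup>2 > 2 * \<beta> - 1) (at_left b)"
      using at_b by (intro order_tendstoD(1))
    moreover have "eventually (\<lambda>a. a \<in> {0<..<b}) (at_left b)"
      using b by (intro eventually_at_left_real) auto
    ultimately have "eventually (\<lambda>a. a \<in> {0<..<b} \<and> (x + a)\<^sup>2 - 2 * a\<^sup>2 > 2 * \<beta> - 1) (at_left b)"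
      by eventually_elim simp
    then obtain a where a: "a \<in> {0<..<b}" "(x + a)\<^sup>2 - 2 * a\<^sup>2 > 2 * \<beta> - 1"
      using eventually_happens'[of "at_left b"] by auto
    then have "a\<^sup>2 < b\<^sup>2" by (intro power_strict_mono) auto
    with a b show ?thesis by (intro that[of a]) (auto simp: x_def)
  qed
qed

section \<open>The rare/weak calibration in terms of the logarithm of \<open>p\<close>\<close>

lemma filterlim_ln_nat: "filterlim (\<lambda>p. ln (real p)) at_top sequentially"
  by real_asymp

lemma eventually_arw:
  assumes "0 < \<beta>" "0 < r"
  shows "eventually (\<lambda>p. ln (real p) > 0 \<and> real p = exp (ln (real p)) \<and> arw_eps \<beta> p = exp (- \<beta> * ln (real p)) \<and>
    0 < arw_eps \<beta> p \<and> arw_eps \<beta> p < 1 \<and> arw_tau r p \<ge> 1 \<and>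
    arw_tau r p = sqrt r * sqrt (2 * ln (real p)) \<and> (arw_tau r p)\<^sup>2 = 2 * r * ln (real p)) sequentially"
proof -
  \<comment> \<open>The level \<open>1 / (2 * r)\<close> forces
    \<open>\<tau>\<^sup>2 = 2 * r * L \<ge> 1\<close>, hence \<open>\<tau> \<ge> 1\<close>.\<close>
  have "eventually (\<lambda>p. ln (real p) \<ge> max 1 (1 / (2 * r))) sequentially"
    using filterlim_ln_nat unfolding filterlim_at_top by blast
  then show ?thesis using eventually_gt_at_top[of 0]
  proof eventually_elim
    case (elim p)
    define L where "L = ln (real p)"
    have L: "L \<ge> 1" "2 * r * L \<ge> 1" using elim assms by (auto simp: L_def field_simps)
    have "arw_eps \<beta> p = exp (- \<beta> * L)" using elim by (simp add: arw_eps_def powr_def L_def)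
    moreover have "\<beta> * L > 0" using assms L by (intro mult_pos_pos) auto
    moreover have "arw_tau r p = sqrt (2 * r * L)" by (simp add: arw_tau_def L_def)
    ultimately show ?case using elim L by (auto simp: L_def[symmetric] real_sqrt_mult[symmetric] mult_ac) (simp_all add: L_def)
  qed
qed

lemma tendsto_sep_upper:
  fixes \<beta> r \<delta>\<^sub>1 \<delta>\<^sub>2 :: real
  assumes "\<delta>\<^sub>1 > 0" "\<delta>\<^sub>2 > 0" "\<beta> > 0" "r > 0"
  shows "((\<lambda>L. 2 * sqrt (2 * r * L) * (exp (- \<delta>\<^sub>1 * L) / sqrt (1 - exp (- \<beta> * L)) + exp (- \<delta>\<^sub>2 * L))) \<longlongrightarrow> 0) at_top"
proof -
  have decay: "((\<lambda>L. 2 * sqrt (2 * r * L) * exp (- (\<delta> * L))) \<longlongrightarrow> 0) at_top" if "\<delta> > 0" for \<delta> :: real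
    using that \<open>r > 0\<close> by real_asymp
  have "((\<lambda>L. 1 / sqrt (1 - exp (- (\<beta> * L)))) \<longlongrightarrow> 1) at_top"
    using \<open>\<beta> > 0\<close> by real_asymp
  from tendsto_add[OF tendsto_mult[OF decay[OF assms(1)] this] decay[OF assms(2)]]
  show ?thesis by (simp add: algebra_simps)
qed

text \<open>The factor \<open>exp (\<delta> * L)\<close> beats both the loss
  \<open>exp (- 2 * a * sqrt (2 * L))\<close> and the power of \<open>L\<close> from the sample
  size. The remaining roots \<open>R\<close> both grow like \<open>sqrt L\<close>, so their quotient
  has a positive limit.\<close>

lemma filterlim_sep_lower:
  fixes a s r c \<gamma> \<delta> :: real
  assumes "\<delta> > 0" "a > 0" "s > 0" "r > 0" "c > 0" "\<gamma> > 0"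
  shows "filterlim (\<lambda>L. exp (\<delta> * L) * exp (- 2 * a * sqrt (2 * L) - 2) * sqrt (2 * r * L) /
     (sqrt (2 * pi) * sqrt (8 * ((1 + s * sqrt (2 * L))\<^sup>2 + 1)) * sqrt (2 * c * L powr \<gamma>))) at_top at_top"
    (is "filterlim ?f at_top at_top")
proof -
  define R where "R = (\<lambda>L. sqrt (2 * r * L) / sqrt (8 * ((1 + s * sqrt (2 * L))\<^sup>2 + 1)))"
  define K where "K = 1 / (sqrt (2 * pi) * sqrt (2 * c))"
  define E where "E = (\<lambda>L. exp (\<delta> * L) * exp (- 2 * a * sqrt (2 * L) - 2) * L powr - (\<gamma> / 2))"
  have E: "filterlim E at_top at_top"
    unfolding E_def using \<open>\<delta> > 0\<close> \<open>\<gamma> > 0\<close> \<open>a > 0\<close> by real_asymp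
  have "(R \<longlongrightarrow> (2 * r) powr (1 / 2) * inverse ((8 * (s * 2 powr (1 / 2))\<^sup>2) powr (1 / 2))) at_top"
    unfolding R_def using \<open>s > 0\<close> \<open>r > 0\<close> by real_asymp
  then have "((\<lambda>L. K * R L) \<longlongrightarrow> K * ((2 * r) powr (1 / 2) * inverse ((8 * (s * 2 powr (1 / 2))\<^sup>2) powr (1 / 2)))) at_top"
    by (intro tendsto_intros)
  moreover have "K * ((2 * r) powr (1 / 2) * inverse ((8 * (s * 2 powr (1 / 2))\<^sup>2) powr (1 / 2))) > 0"
    using assms by (simp add: K_def)
  ultimately have "filterlim (\<lambda>L. K * R L * E L) at_top at_top"
    using E by (rule filterlim_tendsto_pos_mult_at_top)
  moreover have "eventually (\<lambda>L. K * R L * E L = ?f L) at_top"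
    using eventually_gt_at_top[of 0]
  proof eventually_elim
    case (elim L)
    have "sqrt (2 * c * L powr \<gamma>) = sqrt (2 * c) * L powr (\<gamma> / 2)"
      using elim by (simp add: real_sqrt_mult powr_half_sqrt[symmetric] powr_powr)
    then show ?case by (simp add: K_def R_def E_def powr_minus field_simps)
  qed
  ultimately show ?thesis by (rule filterlim_mono_eventually[OF _ order_refl order_refl])
qed

lemma sqrt_exp: "sqrt (exp x) = exp (x / 2)"
  by (rule real_sqrt_unique) (auto simp: power2_eq_square exp_add[symmetric])

section \<open>Upper and lower bounds for the separation as powers of \<open>p\<close>\<close>

context threshold_rule
begin

text \<open>Here \<open>exp (L / 2)\<close> stands for the square root of \<open>p\<close>. The cut
  lies \<open>a * sqrt (2 * L)\<close> above \<open>\<tau>\<close>, so the part above it has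
  exponent \<open>- a\<^sup>2 * L / 2\<close>, while the doubled shift \<open>2 * \<tau>\<close>
  overshoots the cut by \<open>(sqrt r - a) * sqrt (2 * L)\<close> if this is positive.\<close>

lemma proxy_sep_le_exp:
  assumes "0 < \<epsilon>" "\<epsilon> < 1" "L > 0" "t \<ge> 0" "a > 0" "r > 0"
    and \<epsilon>: "\<epsilon> = exp (- \<beta> * L)" and \<tau>: "\<tau> = sqrt r * sqrt (2 * L)" "\<tau>\<^sup>2 = 2 * r * L"
  shows "exp (L / 2) * proxy_sep \<eta> \<epsilon> \<tau> t \<le> 2 * sqrt (2 * r * L) *
    (exp (- (- (1/2 - \<beta> + r - (max 0 (sqrt r - a))\<^sup>2 / 2)) * L) / sqrt (1 - exp (- \<beta> * L))
      + exp (- ((a\<^sup>2 - (1 - \<beta>)) / 2) * L))"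
proof -
  define s where "s = \<tau> + a * sqrt (2 * L)"
  define m where "m = max 0 (sqrt r - a)"
  have \<tau>0: "\<tau> \<ge> 0" using assms by simp
  have "normal_expect (\<lambda>w. indicator {..s} (2 * \<tau> + w)) = normal_expect (indicator {..s - 2 * \<tau>})"
    by (intro arg_cong[where f = normal_expect]) (auto simp: indicator_def)
  also have "\<dots> \<le> exp (- (max 0 (- (s - 2 * \<tau>)))\<^sup>2 / 2)" by (rule normal_lower_tail)
  also have "max 0 (- (s - 2 * \<tau>)) = m * sqrt (2 * L)"
    using \<open>L > 0\<close> by (auto simp: s_def m_def \<tau> max_def algebra_simps)
  also have "- (m * sqrt (2 * L))\<^sup>2 / 2 = - m\<^sup>2 * L"
    using \<open>L > 0\<close> by (simp add: power_mult_distrib)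
  finally have "sqrt (normal_expect (\<lambda>w. indicator {..s} (2 * \<tau> + w))) \<le> sqrt (exp (- m\<^sup>2 * L))"
    by simp
  then have P1: "sqrt (normal_expect (\<lambda>w. indicator {..s} (2 * \<tau> + w))) \<le> exp (- m\<^sup>2 * L / 2)"
    by (simp only: sqrt_exp)
  have "normal_expect (\<lambda>w. indicator {s<..} (\<tau> + w)) = normal_expect (indicator {a * sqrt (2 * L)<..})"
    by (intro arg_cong[where f = normal_expect]) (auto simp: indicator_def s_def)
  also have "\<dots> \<le> exp (- (a * sqrt (2 * L))\<^sup>2 / 2)" using assms by (intro normal_upper_tail) auto
  also have "- (a * sqrt (2 * L))\<^sup>2 / 2 = - a\<^sup>2 * L"
    using \<open>L > 0\<close> by (simp add: power_mult_distrib)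
  finally have "sqrt (normal_expect (\<lambda>w. indicator {s<..} (\<tau> + w))) \<le> sqrt (exp (- a\<^sup>2 * L))"
    by simp
  then have P2: "sqrt (normal_expect (\<lambda>w. indicator {s<..} (\<tau> + w))) \<le> exp (- a\<^sup>2 * L / 2)"
    by (simp only: sqrt_exp)
  have sqrt_eps: "sqrt \<epsilon> = exp (- \<beta> * L / 2)" unfolding \<epsilon> by (rule sqrt_exp)
  have "proxy_sep \<eta> \<epsilon> \<tau> t \<le> 2 * \<epsilon> * \<tau> *
    (exp (\<tau>\<^sup>2 / 2) * sqrt (normal_expect (\<lambda>w. indicator {..s} (2 * \<tau> + w))) / sqrt (1 - \<epsilon>)
      + sqrt (normal_expect (\<lambda>w. indicator {s<..} (\<tau> + w))) / sqrt \<epsilon>)"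
    using assms \<tau>0 by (intro proxy_sep_le_split) auto
  also have "\<dots> \<le> 2 * \<epsilon> * \<tau> * (exp (\<tau>\<^sup>2 / 2) * exp (- m\<^sup>2 * L / 2) / sqrt (1 - \<epsilon>) + exp (- a\<^sup>2 * L / 2) / sqrt \<epsilon>)"
    using P1 P2 assms(1,2) \<tau>0
    by (intro mult_left_mono add_mono divide_right_mono) auto
  finally have "exp (L / 2) * proxy_sep \<eta> \<epsilon> \<tau> t \<le>
      exp (L / 2) * (2 * \<epsilon> * \<tau> * (exp (\<tau>\<^sup>2 / 2) * exp (- m\<^sup>2 * L / 2) / sqrt (1 - \<epsilon>) + exp (- a\<^sup>2 * L / 2) / sqrt \<epsilon>))"
    by (intro mult_left_mono) auto
  also have "\<dots> = 2 * \<tau> * ((exp (L / 2) * \<epsilon> * exp (\<tau>\<^sup>2 / 2) * exp (- m\<^sup>2 * L / 2)) / sqrt (1 - \<epsilon>)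
      + (exp (L / 2) * \<epsilon> * exp (- a\<^sup>2 * L / 2)) / sqrt \<epsilon>)"
    by (simp add: algebra_simps)
  also have "exp (L / 2) * \<epsilon> * exp (\<tau>\<^sup>2 / 2) * exp (- m\<^sup>2 * L / 2) = exp (- (- (1/2 - \<beta> + r - m\<^sup>2 / 2)) * L)"
    unfolding \<epsilon> \<tau>(2) exp_add[symmetric] by (intro arg_cong[where f = exp]) (simp add: field_simps)
  also have "(exp (L / 2) * \<epsilon> * exp (- a\<^sup>2 * L / 2)) / sqrt \<epsilon> = exp (- ((a\<^sup>2 - (1 - \<beta>)) / 2) * L)"
    unfolding sqrt_eps unfolding \<epsilon> exp_add[symmetric] exp_diff[symmetric]
    by (intro arg_cong[where f = exp]) (simp add: field_simps)
  also have "2 * \<tau> = 2 * sqrt (2 * r * L)" unfolding \<tau>(1) by (simp add: real_sqrt_mult)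
  finally show ?thesis by (simp only: m_def \<epsilon>)
qed

text \<open>The test threshold exceeds \<open>\<tau>\<close> by \<open>a * sqrt (2 * L)\<close>. The
  mean then costs \<open>a\<^sup>2\<close> in the exponent, and the denominator decays at the slower
  of the rates of its signal part, \<open>\<beta> + a\<^sup>2\<close>, and its noise part,
  \<open>(sqrt r + a)\<^sup>2\<close>.\<close>

lemma proxy_sep_ge_exp:
  assumes "0 < \<epsilon>" "\<epsilon> < 1" "L > 0" "a > 0" "r > 0" "\<tau> \<ge> 1"
    and \<epsilon>: "\<epsilon> = exp (- \<beta> * L)" and \<tau>: "\<tau> = sqrt r * sqrt (2 * L)"
  shows "exp ((1/2 - \<beta> - a\<^sup>2 + min (\<beta> + a\<^sup>2) ((sqrt r + a)\<^sup>2) / 2) * L) * exp (- 2 * a * sqrt (2 * L) - 2) *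
      sqrt (2 * r * L) / (sqrt (2 * pi) * sqrt (8 * ((1 + (sqrt r + a) * sqrt (2 * L))\<^sup>2 + 1)))
    \<le> exp (L / 2) * proxy_sep \<eta> \<epsilon> \<tau> ((sqrt r + a) * sqrt (2 * L))"
proof -
  define t where "t = (sqrt r + a) * sqrt (2 * L)"
  define \<kappa> where "\<kappa> = min (\<beta> + a\<^sup>2) ((sqrt r + a)\<^sup>2)"
  define K where "K = 4 * ((1 + t)\<^sup>2 + 1)"
  have K: "K > 0" by (simp add: K_def add_nonneg_pos)
  have \<kappa>L: "- (\<beta> + a\<^sup>2) * L \<le> - \<kappa> * L" "- (sqrt r + a)\<^sup>2 * L \<le> - \<kappa> * L"
    using \<open>L > 0\<close> by (intro mult_right_mono; simp add: \<kappa>_def)+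
  have t: "t \<ge> 0" "t - \<tau> = a * sqrt (2 * L)" using assms by (auto simp: t_def \<tau> algebra_simps)
  have "a * sqrt (2 * L) \<ge> 0" using assms by simp
  then have t\<tau>: "\<tau> \<le> t" using t(2) by linarith
  have B: "sep_denom \<eta> \<epsilon> \<tau> t \<le> 2 * K * exp (- \<kappa> * L)"
  proof -
    have "normal_expect (\<lambda>w. (\<eta> t (\<tau> + w))\<^sup>2) \<le> K * exp (- (t - \<tau>)\<^sup>2 / 2)"
      unfolding K_def using assms t\<tau> by (intro square_expect_upper) auto
    also have "- (t - \<tau>)\<^sup>2 / 2 = - a\<^sup>2 * L" unfolding t(2) using assms by (simp add: power_mult_distrib)
    finally have E1: "\<epsilon> * normal_expect (\<lambda>w. (\<eta> t (\<tau> + w))\<^sup>2) \<le> exp (- \<beta> * L) * (K * exp (- a\<^sup>2 * L))"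
      unfolding \<epsilon> by (intro mult_left_mono) auto
    also have "exp (- \<beta> * L) * (K * exp (- a\<^sup>2 * L)) = K * exp (- (\<beta> + a\<^sup>2) * L)"
      by (simp add: exp_add[symmetric] algebra_simps)
    also have "\<dots> \<le> K * exp (- \<kappa> * L)"
      using K assms by (intro mult_left_mono) (simp_all only: exp_le_cancel_iff \<kappa>L order_less_imp_le)
    finally have 1: "\<epsilon> * normal_expect (\<lambda>w. (\<eta> t (\<tau> + w))\<^sup>2) \<le> K * exp (- \<kappa> * L)" .
    have "(1 - \<epsilon>) * normal_expect (\<lambda>w. (\<eta> t w)\<^sup>2) \<le> 1 * normal_expect (\<lambda>w. (\<eta> t w)\<^sup>2)"
      using assms by (intro mult_right_mono) (auto simp: normal_expect_def)
    also have "\<dots> \<le> K * exp (- t\<^sup>2 / 2)"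
      using square_expect_upper[of 0 t] t by (simp add: K_def)
    also have "- t\<^sup>2 / 2 = - (sqrt r + a)\<^sup>2 * L" unfolding t_def using assms by (simp add: power_mult_distrib)
    also have "K * exp (- (sqrt r + a)\<^sup>2 * L) \<le> K * exp (- \<kappa> * L)"
      using K assms by (intro mult_left_mono) (simp_all only: exp_le_cancel_iff \<kappa>L order_less_imp_le)
    finally show ?thesis using 1 by (simp add: sep_denom_def)
  qed
  have m: "std_normal_density (a * sqrt (2 * L) + 2) / 2 \<le> normal_expect (\<lambda>w. \<eta> t (\<tau> + w))"
    using mean_lower[of t \<tau>] assms t t\<tau> by (simp add: algebra_simps)
  have D: "sqrt (sep_denom \<eta> \<epsilon> \<tau> t) \<le> sqrt (2 * K) * exp (- \<kappa> * L / 2)"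
    using B sqrt_exp[of "- \<kappa> * L"] by (metis real_sqrt_le_iff real_sqrt_mult)
  have D0: "sqrt (sep_denom \<eta> \<epsilon> \<tau> t) > 0" using sep_denom_pos[of \<epsilon> t \<tau>] assms t by simp
  have "\<epsilon> * \<tau> * std_normal_density (a * sqrt (2 * L) + 2) / (sqrt (2 * K) * exp (- \<kappa> * L / 2))
      \<le> 2 * (\<epsilon> * \<tau> * normal_expect (\<lambda>w. \<eta> t (\<tau> + w))) / sqrt (sep_denom \<eta> \<epsilon> \<tau> t)"
  proof (rule frac_le)
    have "\<epsilon> * \<tau> * std_normal_density (a * sqrt (2 * L) + 2) = 2 * (\<epsilon> * \<tau> * (std_normal_density (a * sqrt (2 * L) + 2) / 2))"
      by simp
    also have "\<dots> \<le> 2 * (\<epsilon> * \<tau> * normal_expect (\<lambda>w. \<eta> t (\<tau> + w)))"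
      using m assms(1,6) by (intro mult_left_mono) auto
    finally show le: "\<epsilon> * \<tau> * std_normal_density (a * sqrt (2 * L) + 2) \<le> 2 * (\<epsilon> * \<tau> * normal_expect (\<lambda>w. \<eta> t (\<tau> + w)))" .
    have "0 \<le> \<epsilon> * \<tau> * std_normal_density (a * sqrt (2 * L) + 2)" using assms(1,6) by simp
    with le show "0 \<le> 2 * (\<epsilon> * \<tau> * normal_expect (\<lambda>w. \<eta> t (\<tau> + w)))" by linarith
  qed (use D D0 in auto)
  also have "\<dots> = proxy_sep \<eta> \<epsilon> \<tau> t" by (simp add: proxy_sep_def sep_numer_def)
  finally have le: "exp (L / 2) * (\<epsilon> * \<tau> * std_normal_density (a * sqrt (2 * L) + 2) / (sqrt (2 * K) * exp (- \<kappa> * L / 2)))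
     \<le> exp (L / 2) * proxy_sep \<eta> \<epsilon> \<tau> t" by (intro mult_left_mono) auto
  have "exp (L / 2) * (\<epsilon> * \<tau> * std_normal_density (a * sqrt (2 * L) + 2) / (sqrt (2 * K) * exp (- \<kappa> * L / 2))) =
     (exp (L / 2) * \<epsilon> * exp (- (a * sqrt (2 * L) + 2)\<^sup>2 / 2) / exp (- \<kappa> * L / 2)) * \<tau> / (sqrt (2 * pi) * sqrt (2 * K))"
    by (simp add: std_normal_density_def mult_ac)
  also have "exp (L / 2) * \<epsilon> * exp (- (a * sqrt (2 * L) + 2)\<^sup>2 / 2) / exp (- \<kappa> * L / 2) =
     exp ((1/2 - \<beta> - a\<^sup>2 + \<kappa> / 2) * L) * exp (- 2 * a * sqrt (2 * L) - 2)"
  proof -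
    \<comment> \<open>The offset 2 in the density argument comes from \<open>mean_lower\<close>; its
      cross term and square, halved, give the correction
      \<open>exp (- 2 * a * sqrt (2 * L) - 2)\<close>.\<close>
    have "(a * sqrt (2 * L) + 2)\<^sup>2 = 2 * a\<^sup>2 * L + 4 * a * sqrt (2 * L) + 4"
      using assms by (simp add: power2_sum power_mult_distrib)
    then show ?thesis
      unfolding \<epsilon> exp_add[symmetric] exp_diff[symmetric]
      by (intro arg_cong[where f = exp]) (simp add: field_simps)
  qed
  finally have "exp ((1/2 - \<beta> - a\<^sup>2 + \<kappa> / 2) * L) * exp (- 2 * a * sqrt (2 * L) - 2) * \<tau> /
      (sqrt (2 * pi) * sqrt (2 * K)) \<le> exp (L / 2) * proxy_sep \<eta> \<epsilon> \<tau> t"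
    using le by (simp only:)
  moreover have "sqrt (2 * r * L) = \<tau>" unfolding \<tau> by (simp add: real_sqrt_mult)
  moreover have "8 * ((1 + t)\<^sup>2 + 1) = 2 * K" by (simp add: K_def)
  ultimately show ?thesis by (simp only: t_def[symmetric] \<kappa>_def[symmetric])
qed

end

section \<open>Limits of the normalized separation and of the error\<close>

lemma eventually_sample_size:
  fixes n :: "nat \<Rightarrow> nat"
  assumes "c > 0" "(\<lambda>p. real (n p)) \<sim>[at_top] (\<lambda>p. c * ln (real p) powr \<gamma>)"
  shows "eventually (\<lambda>p. n p \<ge> 1 \<and> real (n p) \<le> 2 * c * ln (real p) powr \<gamma>) sequentially"
proof -
  have pos: "eventually (\<lambda>p. c * ln (real p) powr \<gamma> > 0) sequentially"
    using filterlim_ln_nat[THEN filterlim_at_top_dense[THEN iffD1], rule_format, of 0]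
    by eventually_elim (use assms in auto)
  \<comment> \<open>The quotient in \<open>asymp_equiv_def\<close> reads \<open>0 / 0\<close> as 1;
    \<open>pos\<close> rules this case out. Of the window \<open>{1/2<..<2}\<close> used next, the
    lower end gives \<open>n p \<ge> 1\<close> and the upper end the factor
    \<open>2 * c\<close>.\<close>
  have "((\<lambda>p. if real (n p) = 0 \<and> c * ln (real p) powr \<gamma> = 0 then 1 else real (n p) / (c * ln (real p) powr \<gamma>)) \<longlongrightarrow> 1) sequentially"
    using assms(2) by (simp add: asymp_equiv_def)
  then have "eventually (\<lambda>p. (if real (n p) = 0 \<and> c * ln (real p) powr \<gamma> = 0 then 1 else real (n p) / (c * ln (real p) powr \<gamma>)) \<in> {1/2<..<2}) sequentially"
    by (rule topological_tendstoD) auto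
  with pos show ?thesis
  proof eventually_elim
    case (elim p)
    then have "real (n p) / (c * ln (real p) powr \<gamma>) > 1/2" "real (n p) / (c * ln (real p) powr \<gamma>) < 2"
      by (auto split: if_splits)
    with elim(1) have "real (n p) > 0" "real (n p) < 2 * (c * ln (real p) powr \<gamma>)"
      by (auto simp: field_simps intro!: gr0I)
    then show ?case by simp
  qed
qed

text \<open>When the normalized separation is at most 1, the error is at least this value, which
  keeps it away from 0.\<close>

lemma std_normal_cdf_pos: "cdf std_normal_distribution (- (1/2)) > 0"
proof -
  have "0 < std_normal_density (1/2 + 1)" by (simp add: normal_density_pos)
  also have "\<dots> \<le> normal_expect (indicator {1/2..1/2 + 1})" by (rule normal_unit_interval) simp
  also have "\<dots> = normal_expect (\<lambda>w. indicator {1/2..1/2 + 1} (- w))" by (simp add: normal_expect_uminus)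
  also have "\<dots> \<le> normal_expect (indicator {..- (1/2)})"
  proof (rule normal_expect_mono)
    show "integrable std_normal_distribution (indicat_real {..- (1/2)})"
      using integrable_normal_indicator[of "{..- (1/2)}" 0] by simp
  qed (auto simp: indicator_def)
  also have "\<dots> = cdf std_normal_distribution (- (1/2))"
    by (simp add: normal_expect_def cdf_def)
  finally show ?thesis .
qed

lemma ideal_err_eq:
  "ideal_err \<eta> n \<beta> r p = cdf std_normal_distribution (- (1/2) * (sqrt (real p / real (n p)) * ideal_sep \<eta> \<beta> r p))"
  by (simp add: ideal_err_def proxy_err_def ideal_sep_def mult.assoc)

context threshold_rule
begin

text \<open>The bound on \<open>sqrt (real p)\<close> times the separation tends to 0, hence is
  eventually below 1, and division by the root of \<open>n p \<ge> 1\<close> cannot raise it above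
  1.\<close>

lemma normalized_ideal_sep_bounded:
  fixes n :: "nat \<Rightarrow> nat"
  assumes "0 < \<beta>" "\<beta> < 1" "0 < r" "r < rho_star \<beta>" and n: "eventually (\<lambda>p. n p \<ge> 1) sequentially"
  shows "eventually (\<lambda>p. sqrt (real p / real (n p)) * ideal_sep \<eta> \<beta> r p \<le> 1) sequentially"
proof -
  obtain a where a: "a > 0" "a\<^sup>2 > 1 - \<beta>" "1/2 - \<beta> + r - (max 0 (sqrt r - a))\<^sup>2 / 2 < 0"
    using subcritical_exponent[OF assms(1-4)] .
  have "(\<lambda>p. 2 * sqrt (2 * r * ln (real p)) *
    (exp (- (- (1/2 - \<beta> + r - (max 0 (sqrt r - a))\<^sup>2 / 2)) * ln (real p)) / sqrt (1 - exp (- \<beta> * ln (real p)))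
      + exp (- ((a\<^sup>2 - (1 - \<beta>)) / 2) * ln (real p)))) \<longlonglongrightarrow> 0"
    by (rule filterlim_compose[OF tendsto_sep_upper filterlim_ln_nat]) (use a assms in auto)
  then have "eventually (\<lambda>p. 2 * sqrt (2 * r * ln (real p)) *
    (exp (- (- (1/2 - \<beta> + r - (max 0 (sqrt r - a))\<^sup>2 / 2)) * ln (real p)) / sqrt (1 - exp (- \<beta> * ln (real p)))
      + exp (- ((a\<^sup>2 - (1 - \<beta>)) / 2) * ln (real p))) < 1) sequentially"
    by (rule order_tendstoD) simp
  then show ?thesis using n eventually_arw[OF assms(1,3)]
  proof eventually_elim
    case (elim p)
    let ?\<epsilon> = "arw_eps \<beta> p" and ?\<tau> = "arw_tau r p" and ?L = "ln (real p)"
    have "sqrt (real p) = exp (?L / 2)"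
      using elim sqrt_exp by metis
    then have "sqrt (real p) * ideal_sep \<eta> \<beta> r p < 1"
      unfolding ideal_sep_def
      using proxy_sep_le_exp[of ?\<epsilon> ?L "ideal_threshold \<eta> ?\<epsilon> ?\<tau>" a r \<beta> ?\<tau>]
        ideal_threshold_optimal(1)[of ?\<epsilon> ?\<tau>] elim a assms by fastforce
    moreover have n1: "sqrt (real (n p)) \<ge> 1" using elim by simp
    ultimately have "sqrt (real p) * ideal_sep \<eta> \<beta> r p \<le> sqrt (real (n p))" by linarith
    then show ?case using n1 by (simp add: real_sqrt_divide divide_le_eq)
  qed
qed

text \<open>By optimality the ideal threshold does at least as well as the explicit one of
  \<open>proxy_sep_ge_exp\<close>, whose positive exponent outweighs the polylogarithmic sample
  size.\<close>

lemma normalized_ideal_sep_unbounded: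
  fixes n :: "nat \<Rightarrow> nat"
  assumes "0 < \<beta>" "\<beta> < 1" "0 < r" "r > rho_star \<beta>" and "c > 0" "\<gamma> > 0"
    and n: "eventually (\<lambda>p. n p \<ge> 1 \<and> real (n p) \<le> 2 * c * ln (real p) powr \<gamma>) sequentially"
  shows "filterlim (\<lambda>p. sqrt (real p / real (n p)) * ideal_sep \<eta> \<beta> r p) at_top sequentially"
proof -
  obtain a where a: "a > 0" "a\<^sup>2 < 1 - \<beta>" "(sqrt r + a)\<^sup>2 > 2 * \<beta> - 1 + 2 * a\<^sup>2"
    using supercritical_exponent[OF assms(1-4)] .
  define \<delta> where "\<delta> = 1/2 - \<beta> - a\<^sup>2 + min (\<beta> + a\<^sup>2) ((sqrt r + a)\<^sup>2) / 2"
  have \<delta>: "\<delta> > 0" using a by (auto simp: \<delta>_def min_def field_simps)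
  have s: "sqrt r + a > 0" using a assms by (simp add: add_pos_pos)
  have "filterlim (\<lambda>p. exp (\<delta> * ln (real p)) * exp (- 2 * a * sqrt (2 * ln (real p)) - 2) * sqrt (2 * r * ln (real p)) /
     (sqrt (2 * pi) * sqrt (8 * ((1 + (sqrt r + a) * sqrt (2 * ln (real p)))\<^sup>2 + 1)) * sqrt (2 * c * ln (real p) powr \<gamma>)))
     at_top sequentially"
    by (rule filterlim_compose[OF filterlim_sep_lower[OF \<delta> a(1) s assms(3,5,6)] filterlim_ln_nat])
  then show ?thesis
  proof (rule filterlim_at_top_mono)
    show "eventually (\<lambda>p. exp (\<delta> * ln (real p)) * exp (- 2 * a * sqrt (2 * ln (real p)) - 2) * sqrt (2 * r * ln (real p)) /
     (sqrt (2 * pi) * sqrt (8 * ((1 + (sqrt r + a) * sqrt (2 * ln (real p)))\<^sup>2 + 1)) * sqrt (2 * c * ln (real p) powr \<gamma>))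
     \<le> sqrt (real p / real (n p)) * ideal_sep \<eta> \<beta> r p) sequentially"
      using n eventually_arw[OF assms(1,3)]
    proof eventually_elim
      case (elim p)
      let ?\<epsilon> = "arw_eps \<beta> p" and ?\<tau> = "arw_tau r p" and ?L = "ln (real p)"
      let ?t = "(sqrt r + a) * sqrt (2 * ?L)"
      define N where "N = exp (\<delta> * ?L) * exp (- 2 * a * sqrt (2 * ?L) - 2) * sqrt (2 * r * ?L) /
        (sqrt (2 * pi) * sqrt (8 * ((1 + ?t)\<^sup>2 + 1)))"
      have N: "N \<ge> 0" using elim assms by (simp add: N_def)
      have "sqrt (real p) = exp (?L / 2)"
        using elim sqrt_exp by metis
      then have "N \<le> sqrt (real p) * proxy_sep \<eta> ?\<epsilon> ?\<tau> ?t"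
        unfolding N_def \<delta>_def using proxy_sep_ge_exp[of ?\<epsilon> ?L a r ?\<tau> \<beta>] elim a assms by simp
      also have "\<dots> \<le> sqrt (real p) * ideal_sep \<eta> \<beta> r p"
        unfolding ideal_sep_def using elim s by (intro mult_left_mono ideal_threshold_optimal(2)) auto
      finally have le: "N \<le> sqrt (real p) * ideal_sep \<eta> \<beta> r p" .
      have "N / sqrt (2 * c * ?L powr \<gamma>) \<le> sqrt (real p) * ideal_sep \<eta> \<beta> r p / sqrt (real (n p))"
        using le N elim by (intro frac_le) auto
      then show ?case by (simp add: N_def real_sqrt_divide)
    qed
  qed
qed

lemma ideal_err_tendsto_0_if:
  fixes n :: "nat \<Rightarrow> nat"
  assumes "0 < \<beta>" "\<beta> < 1" "0 < r" "r > rho_star \<beta>" and "c > 0" "\<gamma> > 0"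
    and "eventually (\<lambda>p. n p \<ge> 1 \<and> real (n p) \<le> 2 * c * ln (real p) powr \<gamma>) sequentially"
  shows "ideal_err \<eta> n \<beta> r \<longlonglongrightarrow> 0"
proof -
  interpret real_distribution std_normal_distribution by (rule real_dist_normal_dist)
  have "filterlim (\<lambda>p. - (1/2) * (sqrt (real p / real (n p)) * ideal_sep \<eta> \<beta> r p)) at_bot sequentially"
    using normalized_ideal_sep_unbounded[OF assms]
    by (intro filterlim_tendsto_neg_mult_at_bot[OF tendsto_const]) auto
  from filterlim_compose[OF cdf_lim_at_bot this] show ?thesis
    by (simp add: ideal_err_eq[abs_def])
qed

lemma not_ideal_err_tendsto_0_if:
  fixes n :: "nat \<Rightarrow> nat"
  assumes "0 < \<beta>" "\<beta> < 1" "0 < r" "r < rho_star \<beta>" and "eventually (\<lambda>p. n p \<ge> 1) sequentially"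
  shows "\<not> ideal_err \<eta> n \<beta> r \<longlonglongrightarrow> 0"
proof
  interpret real_distribution std_normal_distribution by (rule real_dist_normal_dist)
  assume "ideal_err \<eta> n \<beta> r \<longlonglongrightarrow> 0"
  then have "eventually (\<lambda>p. ideal_err \<eta> n \<beta> r p < cdf std_normal_distribution (- (1/2))) sequentially"
    using std_normal_cdf_pos by (rule order_tendstoD(2))
  with normalized_ideal_sep_bounded[OF assms] have "eventually (\<lambda>p. False) sequentially"
  proof eventually_elim
    case (elim p)
    then have "cdf std_normal_distribution (- (1/2)) \<le> ideal_err \<eta> n \<beta> r p"
      unfolding ideal_err_eq by (intro cdf_nondecreasing) auto
    with elim show ?case by simp
  qed
  then show False by simp
qed

end

section \<open>The boundary curve and the two regions\<close>

lemma continuous_on_rho_star: "continuous_on {0<..<1} rho_star"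
proof -
  \<comment> \<open>The maximum merges the first two branches, so only the junction at
    \<open>3/4\<close> needs matching, where both sides equal \<open>1/4\<close>.\<close>
  have "rho_star \<beta> = (if \<beta> \<le> 3/4 then max 0 (\<beta> - 1/2) else (1 - sqrt (1 - \<beta>))\<^sup>2)" for \<beta>
    by (auto simp: rho_star_def max_def)
  moreover have "continuous_on {0<..<1} (\<lambda>\<beta>. if \<beta> \<le> 3/4 then max 0 (\<beta> - 1/2) else (1 - sqrt (1 - \<beta>))\<^sup>2 :: real)"
  proof -
    have "continuous_on ({..3/4} \<union> {3/4..}) (\<lambda>\<beta>. if \<beta> \<le> 3/4 then max 0 (\<beta> - 1/2) else (1 - sqrt (1 - \<beta>))\<^sup>2 :: real)"
    proof (intro continuous_on_If continuous_intros)
      fix x :: real assume "x \<in> {3/4..}" "x \<le> 3/4"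
      then have x: "x = 3/4" by simp
      show "max 0 (x - 1/2) = (1 - sqrt (1 - x))\<^sup>2"
        unfolding x by (simp add: real_sqrt_divide power2_eq_square)
    qed auto
    then show ?thesis by (rule continuous_on_subset) auto
  qed
  ultimately show ?thesis by simp
qed

lemma open_above_below_rho_star:
  "open {(\<beta>, r). (\<beta>, r) \<in> arw_square \<and> r > rho_star \<beta>}"
  "open {(\<beta>, r). (\<beta>, r) \<in> arw_square \<and> r < rho_star \<beta>}"
proof -
  have "continuous_on arw_square (\<lambda>x. rho_star (fst x))"
    unfolding arw_square_def
    by (rule continuous_on_compose2[OF continuous_on_rho_star]) (auto intro!: continuous_intros)
  then have diff: "continuous_on arw_square (\<lambda>x. snd x - rho_star (fst x))"
    by (intro continuous_intros)
  have sq: "open arw_square" by (simp add: arw_square_def open_Times)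
  have "{(\<beta>, r). (\<beta>, r) \<in> arw_square \<and> r > rho_star \<beta>} = (\<lambda>x. snd x - rho_star (fst x)) -` {0<..} \<inter> arw_square"
    by auto
  with continuous_open_preimage[OF diff sq, of "{0<..}"]
  show "open {(\<beta>, r). (\<beta>, r) \<in> arw_square \<and> r > rho_star \<beta>}" by (simp add: Int_commute)
  have "{(\<beta>, r). (\<beta>, r) \<in> arw_square \<and> r < rho_star \<beta>} = (\<lambda>x. snd x - rho_star (fst x)) -` {..<0} \<inter> arw_square"
    by auto
  with continuous_open_preimage[OF diff sq, of "{..<0}"]
  show "open {(\<beta>, r). (\<beta>, r) \<in> arw_square \<and> r < rho_star \<beta>}" by (simp add: Int_commute)
qed

text \<open>Disposes of the curve \<open>r = rho_star \<beta>\<close> itself, where the exponent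
  bounds decide nothing: an interior point brings along points of the set directly above and below
  it.\<close>

lemma interior_vertical:
  fixes S :: "(real \<times> real) set"
  assumes "(\<beta>, r) \<in> interior S"
  obtains e where "e > 0" "(\<beta>, r + e) \<in> S" "(\<beta>, r - e) \<in> S"
proof -
  obtain e where e: "e > 0" "ball (\<beta>, r) e \<subseteq> S" using assms unfolding mem_interior by blast
  have "(\<beta>, r + e / 2) \<in> ball (\<beta>, r) e" "(\<beta>, r - e / 2) \<in> ball (\<beta>, r) e"
    using e(1) by (auto simp: dist_Pair_Pair dist_real_def)
  with e show ?thesis by (intro that[of "e / 2"]) auto
qed

theorem theorem2:
  fixes \<eta> :: "real \<Rightarrow> real \<Rightarrow> real" and n :: "nat \<Rightarrow> nat" and c \<gamma> :: real
  assumes "\<eta> \<in> {clip_thresh, hard_thresh, soft_thresh}"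
    and "c > 0" and "\<gamma> > 0"
    and "(\<lambda>p. real (n p)) \<sim>[at_top] (\<lambda>p. c * ln (real p) powr \<gamma>)"
  shows "success_region \<eta> n = {(\<beta>, r). (\<beta>, r) \<in> arw_square \<and> r > rho_star \<beta>} \<and>
         interior (arw_square - success_region \<eta> n) =
           {(\<beta>, r). (\<beta>, r) \<in> arw_square \<and> 1/2 < \<beta> \<and> r < rho_star \<beta>} \<and>
         (\<forall>\<beta> r. (\<beta>, r) \<in> arw_square \<and> 1/2 < \<beta> \<and> r < rho_star \<beta> \<longrightarrow>
           \<not> filterlim (\<lambda>p. sqrt (real p / real (n p)) * ideal_sep \<eta> \<beta> r p) at_top at_top)"
proof -
  interpret threshold_rule \<eta>
    using assms(1) threshold_rule_clip threshold_rule_hard threshold_rule_soft by auto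
  have n: "eventually (\<lambda>p. n p \<ge> 1 \<and> real (n p) \<le> 2 * c * ln (real p) powr \<gamma>) sequentially"
    using assms(2,4) by (rule eventually_sample_size)
  then have n1: "eventually (\<lambda>p. n p \<ge> 1) sequentially" by (rule eventually_mono) simp
  define S where "S = {(\<beta>, r). (\<beta>, r) \<in> arw_square \<and> ideal_err \<eta> n \<beta> r \<longlonglongrightarrow> 0}"
  define P where "P = {(\<beta>, r). (\<beta>, r) \<in> arw_square \<and> r > rho_star \<beta>}"
  define Q where "Q = {(\<beta>, r). (\<beta>, r) \<in> arw_square \<and> r < rho_star \<beta>}"
  have "P \<subseteq> S"
    using ideal_err_tendsto_0_if[OF _ _ _ _ assms(2,3) n] by (auto simp: P_def S_def arw_square_def)
  have "Q \<inter> S = {}"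
    using not_ideal_err_tendsto_0_if[OF _ _ _ _ n1] by (auto simp: Q_def S_def arw_square_def)
  have P: "open P" and Q: "open Q" unfolding P_def Q_def by (rule open_above_below_rho_star)+
  have "interior S \<subseteq> P"
  proof clarify
    fix \<beta> r assume mem: "(\<beta>, r) \<in> interior S"
    then obtain e where e: "e > 0" "(\<beta>, r - e) \<in> S" by (rule interior_vertical)
    \<comment> \<open>Error tending to 0 at the lower point gives
      \<open>r - e \<ge> rho_star \<beta>\<close>, hence the strict inequality at
      \<open>r\<close>.\<close>
    then have "(\<beta>, r - e) \<notin> Q" using \<open>Q \<inter> S = {}\<close> by auto
    with e have "r > rho_star \<beta>" by (auto simp: Q_def S_def)
    moreover have "(\<beta>, r) \<in> S" using mem interior_subset by blast
    ultimately show "(\<beta>, r) \<in> P" by (simp add: P_def S_def)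
  qed
  with \<open>P \<subseteq> S\<close> P have success: "success_region \<eta> n = P"
    unfolding success_region_def S_def[symmetric] by (intro equalityI interior_maximal)
  have "interior (arw_square - P) \<subseteq> Q"
  proof clarify
    fix \<beta> r assume mem: "(\<beta>, r) \<in> interior (arw_square - P)"
    then obtain e where "e > 0" "(\<beta>, r + e) \<in> arw_square - P" by (rule interior_vertical)
    \<comment> \<open>The upper point is outside \<open>P\<close>, so
      \<open>r + e \<le> rho_star \<beta>\<close>.\<close>
    then have "r < rho_star \<beta>" by (auto simp: P_def)
    moreover have "(\<beta>, r) \<in> arw_square" using mem interior_subset by blast
    ultimately show "(\<beta>, r) \<in> Q" by (simp add: Q_def)
  qed
  moreover have "Q \<subseteq> arw_square - P" by (auto simp: P_def Q_def)
  ultimately have "interior (arw_square - P) = Q" using Q by (intro equalityI interior_maximal)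
  \<comment> \<open>For \<open>\<beta> \<le> 1/2\<close> the curve is at height 0 and no point of
    the open square lies below it.\<close>
  moreover have "Q = {(\<beta>, r). (\<beta>, r) \<in> arw_square \<and> 1/2 < \<beta> \<and> r < rho_star \<beta>}"
    by (auto simp: Q_def arw_square_def rho_star_def split: if_splits)
  moreover have "\<not> filterlim (\<lambda>p. sqrt (real p / real (n p)) * ideal_sep \<eta> \<beta> r p) at_top at_top"
    if "(\<beta>, r) \<in> arw_square" "r < rho_star \<beta>" for \<beta> r
  proof
    assume "filterlim (\<lambda>p. sqrt (real p / real (n p)) * ideal_sep \<eta> \<beta> r p) at_top at_top"
    then have "eventually (\<lambda>p. sqrt (real p / real (n p)) * ideal_sep \<eta> \<beta> r p > 1) sequentially"
      by (simp add: filterlim_at_top_dense)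
    moreover have "eventually (\<lambda>p. sqrt (real p / real (n p)) * ideal_sep \<eta> \<beta> r p \<le> 1) sequentially"
      using that n1 by (intro normalized_ideal_sep_bounded) (auto simp: arw_square_def)
    ultimately have "eventually (\<lambda>p. False) sequentially" by eventually_elim simp
    then show False by simp
  qed
  ultimately show ?thesis unfolding success P_def[symmetric] by blast
qed

end
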